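(* Let $\mathcal K$ be a finite-dimensional complex Hilbert space and $\Lambda$ the Lagrangian Grassmannian of $(\mathcal K\oplus\mathcal K,\omega)$. Suppose $\mathcal L:(-1,1)\to\Lambda$ is a continuous path that is differentiable and increasing on $(-1,0)\cup(0,1)$, and set $\mathcal L_0:=\mathcal L(0)$. For any $\mathcal L_1,\mathcal L_2,\mathcal L_3\in\Lambda$ and all $t\neq0$ with $|t|$ sufficiently small, the following hold: $$\iota(\mathcal L(t),\mathcal L_2,\mathcal L_3)=\iota(\mathcal L_0,\mathcal L_2,\mathcal L_3)+\begin{cases}0,&t<0,\\ \dim(\mathcal L_2\cap\mathcal L_0)-\dim(\mathcal L_3\cap\mathcal L_0),&t>0,\end{cases}$$ $$\phantom{\iota(\mathcal L(t),\mathcal L_2,\mathcal L_3)}=\begin{cases}\iota(\mathcal L_0,\mathcal L_2,\mathcal L_3),&t<0,\\ \iota(\mathcal L_2,\mathcal L_3,\mathcal L_0),&t>0,\end{cases}$$ $$\iota(\mathcal L_1,\mathcal L(t),\mathcal L_3)=\iota(\mathcal L_1,\mathcal L_0,\mathcal L_3)+\begin{cases}\dim(\mathcal L_1\cap\mathcal L_0),&t<0,\\ \dim(\mathcal L_3\cap\mathcal L_0),&t>0,\end{cases}$$ $$\iota(\mathcal L_1,\mathcal L_2,\mathcal L(t))=\iota(\mathcal L_1,\mathcal L_2,\mathcal L_0)+\begin{cases}\dim(\mathcal L_2\cap\mathcal L_0)-\dim(\mathcal L_1\cap\mathcal L_0),&t<0,\\ 0,&t>0,\end{cases}$$ $$\phantom{\iota(\mathcal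 L_1,\mathcal L_2,\mathcal L(t))}=\begin{cases}\iota(\mathcal L_0,\mathcal L_1,\mathcal L_2),&t<0,\\ \iota(\mathcal L_1,\mathcal L_2,\mathcal L_0),&t>0.\end{cases}$$
   Context: Inner products are linear in the second argument. The symplectic form is $\omega(u,v)=\langle u_0,v_1\rangle_{\mathcal K}-\langle u_1,v_0\rangle_{\mathcal K}$ for $u=(u_0,u_1)$, $v=(v_0,v_1)\in\mathcal K\oplus\mathcal K$. A subspace $\mathcal L$ is Lagrangian if $\mathcal L=\{u:\omega(u,v)=0\ \forall v\in\mathcal L\}$; $\Lambda$ is the set of Lagrangian subspaces, with topology given by the gap metric $\|P_{\mathcal L}-P_{\mathcal L'}\|$ ($P_{\mathcal L}$ the orthogonal projection onto $\mathcal L$) and its standard smooth manifold structure (a path $\mathcal L(t)$ is differentiable iff $t\mapsto P_{\mathcal L(t)}$ is differentiable). Crossing form: for a differentiable path $\mathcal L(\cdot)$ in $\Lambda$ and $u,v\in\mathcal L(t_0)$, $\mathfrak q(u,v):=\frac{d}{dt}\omega(u,\tilde v(t))|_{t=t_0}$, where $\tilde v(t)$ is any differentiable path in $\mathcal K\oplus\mathcal K$ with $\tilde v(t_0)=v$ and $\tilde v(t)\in\mathcal L(t)$ for $t$ near $t_0$; this is independent of the choice of $\tilde v$ and Hermitian. The path is increasing if the crossing form $\mathfrak q=\mathfrak q_{t_0}$ on $\mathcal L(t_0)$ is positive (definite) at every $t_0$. Duistermaat index: for Lagrangian planes $\alpha,\beta,\gamma$ with $\alpha\cap\beta=0=\beta\cap\gamma$,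 $\gamma$ is the graph $\{u+Lu:u\in\alpha\}$ of a linear map $L:\alpha\to\beta$; let $Q(\alpha,\beta;\gamma)$ be the Hermitian form $(u_1,u_2)\mapsto\omega(u_1,Lu_2)$ on $\alpha$, and let $n_-$ of a Hermitian form be the maximal dimension of a subspace on which it is negative definite. For arbitrary Lagrangian planes $\mathcal L_1,\mathcal L_2,\mathcal L_3$, choose a Lagrangian plane $\hat{\mathcal L}$ transversal to all three and set $\iota(\mathcal L_1,\mathcal L_2,\mathcal L_3):=n_-(Q(\mathcal L_2,\hat{\mathcal L};\mathcal L_3))-n_-(Q(\mathcal L_1,\hat{\mathcal L};\mathcal L_3))+n_-(Q(\mathcal L_1,\hat{\mathcal L};\mathcal L_2))$, which does not depend on the choice of $\hat{\mathcal L}$. *)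

theory Defs
  imports "HOL-Analysis.Analysis"
begin

section \<open>Finite-dimensional complex Hilbert spaces\<close>

text \<open>
  The complex inner product is linear in its second argument, and its real part is the inner
  product of \<^class>\<open>real_inner\<close>, so norm and topology are the ones of that class. Completeness is
  automatic in finite dimension. The zero space is not excluded.
\<close>

class fd_complex_hilbert = real_inner +
  fixes scaleC :: "complex \<Rightarrow> 'a \<Rightarrow> 'a" (infixr \<open>*\<^sub>C\<close> 75)
    and cinner :: "'a \<Rightarrow> 'a \<Rightarrow> complex"
  assumes scaleC_add_right: "c *\<^sub>C (x + y) = c *\<^sub>C x + c *\<^sub>C y"
    and scaleC_add_left: "(c + d) *\<^sub>C x = c *\<^sub>C x + d *\<^sub>C x"
    and scaleC_scaleC: "c *\<^sub>C (d *\<^sub>C x) = (c * d) *\<^sub>C x"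
    and scaleR_scaleC: "r *\<^sub>R x = complex_of_real r *\<^sub>C x"
    and cinner_add_right: "cinner x (y + z) = cinner x y + cinner x z"
    and cinner_scaleC_right: "cinner x (c *\<^sub>C y) = c * cinner x y"
    and cinner_commute: "cinner x y = cnj (cinner y x)"
    and inner_eq_Re_cinner: "inner x y = Re (cinner x y)"
    and finite_spanning: "\<exists>B. finite B \<and> (\<forall>x. \<exists>c. x = (\<Sum>b\<in>B. c b *\<^sub>C b))"

global_interpretation complex_vector:
  vector_space "scaleC :: complex \<Rightarrow> 'a \<Rightarrow> 'a :: fd_complex_hilbert"
  defines csubspace = complex_vector.subspace
    and cspan = complex_vector.span
    and cdependent = complex_vector.dependent
    and cdim = complex_vector.dim
proof
  show "1 *\<^sub>C x = x" for x :: 'a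
    using scaleR_scaleC[of 1 x] by simp
qed (auto simp: scaleC_add_right scaleC_add_left scaleC_scaleC)

lemma finite_cspan: "\<exists>B :: 'a :: fd_complex_hilbert set. finite B \<and> cspan B = UNIV"
proof -
  obtain B :: "'a set" where B: "finite B" "\<And>x. \<exists>c. x = (\<Sum>b\<in>B. c b *\<^sub>C b)"
    using finite_spanning by metis
  have "x \<in> cspan B" for x
  proof -
    obtain c where "x = (\<Sum>b\<in>B. c b *\<^sub>C b)" using B(2) by blast
    then show ?thesis
      by (simp only: complex_vector.span_sum complex_vector.span_scale complex_vector.span_base)
  qed
  then show ?thesis using B(1) by blast
qed

lemma cinner_add_left: "cinner (x + y) z = cinner x z + cinner y z"
  by (subst (1 2 3) cinner_commute) (simp add: cinner_add_right)

lemma cinner_scaleC_left: "cinner (c *\<^sub>C x) y = cnj c * cinner x y"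
  by (subst (1 2) cinner_commute) (simp add: cinner_scaleC_right)

lemma cinner_zero_right [simp]: "cinner x 0 = 0"
  using cinner_add_right[of x 0 0] by simp

lemma cinner_zero_left [simp]: "cinner 0 x = 0"
  using cinner_add_left[of 0 0 x] by simp

lemma cinner_diff_right: "cinner x (y - z) = cinner x y - cinner x z"
  using cinner_add_right[of x "y - z" z] by simp

lemma cinner_self_eq_0_iff: "cinner x x = 0 \<longleftrightarrow> x = 0"
  using inner_eq_Re_cinner[of x x] inner_eq_zero_iff[of x] by auto

lemma finite_cindependent:
  assumes "\<not> cdependent (B :: 'a :: fd_complex_hilbert set)"
  shows "finite B"
proof -
  obtain C :: "'a set" where C: "finite C" "cspan C = UNIV"
    using finite_cspan by blast
  then show ?thesis
    using complex_vector.independent_span_bound[OF C(1) assms] by auto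
qed

lemma csubspace_finite_cspan:
  assumes "csubspace (S :: 'a :: fd_complex_hilbert set)"
  obtains B where "finite B" "cspan B = S"
proof -
  obtain B where "B \<subseteq> S" "\<not> cdependent B" "S \<subseteq> cspan B"
    using complex_vector.maximal_independent_subset[of S] by metis
  then show ?thesis
    using that finite_cindependent complex_vector.span_minimal[OF _ assms] by blast
qed

instantiation prod :: (fd_complex_hilbert, fd_complex_hilbert) fd_complex_hilbert
begin

definition "c *\<^sub>C u = (c *\<^sub>C fst u, c *\<^sub>C snd u)"
definition "cinner u v = cinner (fst u) (fst v) + cinner (snd u) (snd v)"

instance
proof
  have vs: "vector_space (scaleC :: complex \<Rightarrow> 'a \<times> 'b \<Rightarrow> 'a \<times> 'b)"
    by unfold_locales
      (auto simp: scaleC_prod_def scaleC_add_right scaleC_add_left scaleC_scaleC)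
  interpret P: vector_space "scaleC :: complex \<Rightarrow> 'a \<times> 'b \<Rightarrow> 'a \<times> 'b"
    by (fact vs)
  obtain A :: "'a set" where A: "finite A" "cspan A = UNIV"
    using finite_cspan by blast
  obtain B :: "'b set" where B: "finite B" "cspan B = UNIV"
    using finite_cspan by blast
  let ?C = "(\<lambda>a. (a, 0)) ` A \<union> (\<lambda>b. (0, b)) ` B :: ('a \<times> 'b) set"
  have "(a, 0) \<in> P.span ?C" for a
  proof -
    have "a \<in> cspan A" using A by simp
    then show ?thesis
    proof (induction rule: complex_vector.span_induct_alt)
      case base
      then show ?case using P.span_zero by (simp add: zero_prod_def)
    next
      case (step c x y)
      have "(x, 0) \<in> P.span ?C" using step by (auto intro: P.span_base)
      then have "c *\<^sub>C (x, 0) + (y, 0) \<in> P.span ?C"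
        by (intro P.span_add P.span_scale step)
      moreover have "c *\<^sub>C (x, 0) + (y, 0) = (c *\<^sub>C x + y, 0)"
        by (simp add: scaleC_prod_def)
      ultimately show ?case by (simp only:)
    qed
  qed
  moreover have "(0, b) \<in> P.span ?C" for b
  proof -
    have "b \<in> cspan B" using B by simp
    then show ?thesis
    proof (induction rule: complex_vector.span_induct_alt)
      case base
      then show ?case using P.span_zero by (simp add: zero_prod_def)
    next
      case (step c x y)
      have "(0, x) \<in> P.span ?C" using step by (auto intro: P.span_base)
      then have "c *\<^sub>C (0, x) + (0, y) \<in> P.span ?C"
        by (intro P.span_add P.span_scale step)
      moreover have "c *\<^sub>C (0, x) + (0, y) = (0, c *\<^sub>C x + y)"
        by (simp add: scaleC_prod_def)
      ultimately show ?case by (simp only:)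
    qed
  qed
  ultimately have "(a, 0) + (0, b) \<in> P.span ?C" for a b
    by (intro P.span_add)
  then have "(a, b) \<in> P.span ?C" for a b by (metis add.right_neutral add.left_neutral add_Pair)
  moreover have "finite ?C" using A B by simp
  ultimately have "x \<in> range (\<lambda>c. \<Sum>b\<in>?C. c b *\<^sub>C b)" for x
    by (cases x) (simp only: P.span_finite[symmetric])
  with \<open>finite ?C\<close> show "\<exists>B. finite B \<and> (\<forall>x :: 'a \<times> 'b. \<exists>c. x = (\<Sum>b\<in>B. c b *\<^sub>C b))"
    by (intro exI[of _ ?C]) blast
  fix x y z :: "'a \<times> 'b"
  show "cinner x y = cnj (cinner y x)"
    unfolding cinner_prod_def
    by (metis cinner_commute complex_cnj_add)
qed (auto simp: scaleC_prod_def cinner_prod_def scaleC_add_right scaleC_add_left scaleC_scaleC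
    scaleR_scaleC cinner_add_right cinner_scaleC_right inner_prod_def inner_eq_Re_cinner
    algebra_simps prod_eq_iff)

end

text \<open>The coordinate spaces \<open>complex ^ 'n\<close> with their standard inner product are instances.\<close>

instantiation complex :: fd_complex_hilbert
begin

definition "(c :: complex) *\<^sub>C (z :: complex) = c * z"
definition "cinner (z :: complex) w = cnj z * w"

instance
proof
  have "z = (\<Sum>b\<in>{1}. z *\<^sub>C b)" for z :: complex
    by (simp add: scaleC_complex_def)
  then show "\<exists>B. finite B \<and> (\<forall>x :: complex. \<exists>c. x = (\<Sum>b\<in>B. c b *\<^sub>C b))"
    by (intro exI[of _ "{1}"]) auto
qed (auto simp: scaleC_complex_def cinner_complex_def algebra_simps inner_complex_def
    scaleR_conv_of_real)

end

instantiation vec :: (fd_complex_hilbert, finite) fd_complex_hilbert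
begin

definition "c *\<^sub>C (x :: ('a, 'b) vec) = (\<chi> i. c *\<^sub>C (x $ i))"
definition "cinner (x :: ('a, 'b) vec) y = (\<Sum>i\<in>UNIV. cinner (x $ i) (y $ i))"

instance
proof
  interpret P: vector_space "scaleC :: complex \<Rightarrow> ('a, 'b) vec \<Rightarrow> ('a, 'b) vec"
    by unfold_locales
      (auto simp: scaleC_vec_def vec_eq_iff scaleC_add_right scaleC_add_left scaleC_scaleC)
  obtain A :: "'a set" where A: "finite A" "cspan A = UNIV"
    using finite_cspan by blast
  let ?C = "(\<lambda>(i, a). axis i a) ` (UNIV \<times> A) :: ('a, 'b) vec set"
  have axis: "axis i a \<in> P.span ?C" for i a
  proof -
    have "a \<in> cspan A" using A by simp
    then show ?thesis
    proof (induction rule: complex_vector.span_induct_alt)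
      case base
      have "axis i 0 = (0 :: ('a, 'b) vec)" by (simp add: axis_def vec_eq_iff)
      then show ?case by (metis P.span_zero)
    next
      case (step c x y)
      have "axis i x \<in> P.span ?C" using step by (auto intro!: P.span_base)
      then have "c *\<^sub>C axis i x + axis i y \<in> P.span ?C"
        by (intro P.span_add P.span_scale step)
      moreover have "c *\<^sub>C axis i x + axis i y = axis i (c *\<^sub>C x + y)"
        by (simp add: scaleC_vec_def axis_def vec_eq_iff)
      ultimately show ?case by simp
    qed
  qed
  have "x \<in> P.span ?C" for x
  proof -
    have "(\<Sum>i\<in>UNIV. axis i (x $ i)) \<in> P.span ?C" by (intro P.span_sum axis)
    moreover have "(\<Sum>i\<in>UNIV. axis i (x $ i)) = x"
      by (simp add: vec_eq_iff axis_def)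
    ultimately show ?thesis by simp
  qed
  moreover have "finite ?C" using A by simp
  ultimately have "x \<in> range (\<lambda>c. \<Sum>b\<in>?C. c b *\<^sub>C b)" for x
    by (simp only: P.span_finite[symmetric])
  with \<open>finite ?C\<close> show "\<exists>B. finite B \<and> (\<forall>x :: ('a, 'b) vec. \<exists>c. x = (\<Sum>b\<in>B. c b *\<^sub>C b))"
    by (intro exI[of _ ?C]) blast
  fix x y :: "('a, 'b) vec"
  show "cinner x y = cnj (cinner y x)"
    unfolding cinner_vec_def cnj_sum by (intro sum.cong refl cinner_commute)
qed (auto simp: scaleC_vec_def cinner_vec_def vec_eq_iff scaleC_add_right scaleC_add_left
    scaleC_scaleC scaleR_scaleC cinner_add_right cinner_scaleC_right inner_vec_def
    inner_eq_Re_cinner sum.distrib sum_distrib_left)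

end


section \<open>Orthogonal projections\<close>

definition orth_proj :: "'a :: fd_complex_hilbert set \<Rightarrow> 'a \<Rightarrow>\<^sub>L 'a" where
  "orth_proj S = Blinfun (\<lambda>u. THE v. v \<in> S \<and> (\<forall>w\<in>S. cinner w (u - v) = 0))"

lemma orth_proj_ex_cspan:
  assumes "finite (B :: 'a :: fd_complex_hilbert set)"
  shows "\<exists>v\<in>cspan B. \<forall>w\<in>cspan B. cinner w (u - v) = 0"
  using assms
proof (induction B arbitrary: u)
  case empty
  then show ?case by simp
next
  case (insert b B)
  obtain p where p: "p \<in> cspan B" "\<forall>w\<in>cspan B. cinner w (b - p) = 0"
    using insert.IH by blast
  obtain v where v: "v \<in> cspan B" "\<forall>w\<in>cspan B. cinner w (u - v) = 0"
    using insert.IH by blast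
  define d where "d = b - p"
  define k where "k = cinner d (u - v) / cinner d d"
  have sub: "cspan B \<subseteq> cspan (insert b B)"
    by (intro complex_vector.span_mono) auto
  have "b \<in> cspan (insert b B)" by (intro complex_vector.span_base) auto
  then have d: "d \<in> cspan (insert b B)"
    unfolding d_def using p sub by (intro complex_vector.span_diff) auto
  show ?case
  proof (intro bexI[of _ "v + k *\<^sub>C d"] ballI)
    show "v + k *\<^sub>C d \<in> cspan (insert b B)"
      using d v sub by (intro complex_vector.span_add complex_vector.span_scale) auto
    fix w assume "w \<in> cspan (insert b B)"
    then obtain c where c: "w - c *\<^sub>C b \<in> cspan B"
      using complex_vector.span_breakdown_eq by blast
    define s where "s = (w - c *\<^sub>C b) + c *\<^sub>C p"
    have s: "s \<in> cspan B"
      unfolding s_def using c p by (intro complex_vector.span_add complex_vector.span_scale)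
    have w: "w = s + c *\<^sub>C d"
      by (simp add: s_def d_def complex_vector.scale_right_diff_distrib)
    have "cinner d (u - (v + k *\<^sub>C d)) = cinner d (u - v) - k * cinner d d"
      by (simp add: cinner_diff_right cinner_add_right cinner_scaleC_right)
    also have "\<dots> = 0"
      using cinner_self_eq_0_iff[of d] by (cases "d = 0") (auto simp: k_def)
    finally have 1: "cinner d (u - (v + k *\<^sub>C d)) = 0" .
    have "cinner s (u - (v + k *\<^sub>C d)) = cinner s (u - v) - k * cinner s d"
      by (simp add: cinner_diff_right cinner_add_right cinner_scaleC_right)
    also have "\<dots> = 0" using v p s by (simp add: d_def)
    finally show "cinner w (u - (v + k *\<^sub>C d)) = 0"
      by (simp add: w cinner_add_left cinner_scaleC_left 1)
  qed
qed

lemma orth_proj_ex1: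
  assumes "csubspace (S :: 'a :: fd_complex_hilbert set)"
  shows "\<exists>!v. v \<in> S \<and> (\<forall>w\<in>S. cinner w (u - v) = 0)"
proof -
  obtain v where v: "v \<in> S \<and> (\<forall>w\<in>S. cinner w (u - v) = 0)"
    using csubspace_finite_cspan[OF assms] orth_proj_ex_cspan by metis
  then show ?thesis
  proof (rule ex1I)
    fix v' assume v': "v' \<in> S \<and> (\<forall>w\<in>S. cinner w (u - v') = 0)"
    have "v' - v \<in> S" using v v' complex_vector.subspace_diff[OF assms] by blast
    then have "cinner (v' - v) ((u - v) - (u - v')) = 0"
      using v v' by (subst cinner_diff_right) simp
    then show "v' = v" by (simp add: cinner_self_eq_0_iff)
  qed
qed

lemma orth_proj_apply:
  assumes "csubspace (S :: 'a :: fd_complex_hilbert set)"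
  shows "blinfun_apply (orth_proj S) u = (THE v. v \<in> S \<and> (\<forall>w\<in>S. cinner w (u - v) = 0))"
proof -
  define p where "p u = (THE v. v \<in> S \<and> (\<forall>w\<in>S. cinner w (u - v) = 0))" for u
  have p: "p u \<in> S" "\<And>w. w \<in> S \<Longrightarrow> cinner w (u - p u) = 0" for u
    using theI'[OF orth_proj_ex1[OF assms, of u]] unfolding p_def by auto
  have pI: "p u = v" if "v \<in> S" "\<And>w. w \<in> S \<Longrightarrow> cinner w (u - v) = 0" for u v
    unfolding p_def using orth_proj_ex1[OF assms, of u] that by (intro the1_equality conjI) auto
  have "bounded_linear p"
  proof (intro bounded_linear_intro[where K = 1])
    show "p (x + y) = p x + p y" for x y
    proof (rule pI)
      show "p x + p y \<in> S" using p complex_vector.subspace_add[OF assms] by blast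
      show "cinner w (x + y - (p x + p y)) = 0" if "w \<in> S" for w
        using p(2)[OF that, of x] p(2)[OF that, of y]
        by (simp add: cinner_diff_right cinner_add_right)
    qed
    show "p (r *\<^sub>R x) = r *\<^sub>R p x" for r x
    proof (rule pI)
      show "r *\<^sub>R p x \<in> S"
        using p complex_vector.subspace_scale[OF assms] by (simp add: scaleR_scaleC)
      show "cinner w (r *\<^sub>R x - r *\<^sub>R p x) = 0" if "w \<in> S" for w
        using p(2)[OF that, of x]
        by (simp add: scaleR_scaleC cinner_diff_right cinner_scaleC_right)
    qed
    show "norm (p x) \<le> norm x * 1" for x
    proof -
      have "inner (p x) (x - p x) = 0"
        using p(2)[OF p(1), of x x] by (simp add: inner_eq_Re_cinner)
      then have "norm (p x) * norm (p x) = inner (p x) x"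
        by (simp add: inner_diff_right dot_square_norm power2_eq_square)
      also have "\<dots> \<le> norm (p x) * norm x" by (rule norm_cauchy_schwarz)
      finally show ?thesis by (cases "p x = 0") auto
    qed
  qed
  then show ?thesis
    unfolding orth_proj_def p_def[symmetric] by (simp add: bounded_linear_Blinfun_apply)
qed


section \<open>The Lagrangian Grassmannian\<close>

definition omega :: "'k :: fd_complex_hilbert \<times> 'k \<Rightarrow> 'k \<times> 'k \<Rightarrow> complex" where
  "omega u v = cinner (fst u) (snd v) - cinner (snd u) (fst v)"

definition Lagrangian :: "('k :: fd_complex_hilbert \<times> 'k) set \<Rightarrow> bool" where
  "Lagrangian L \<longleftrightarrow> csubspace L \<and> L = {u. \<forall>v\<in>L. omega u v = 0}"

text \<open>
  Continuity and differentiability of a path of Lagrangian planes are those of its path of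
  orthogonal projections, in the operator norm of \<^typ>\<open>'a \<Rightarrow>\<^sub>L 'a\<close>; for continuity this is
  the topology of the gap metric.
\<close>

definition Lagrangian_path :: "real set \<Rightarrow> (real \<Rightarrow> ('k :: fd_complex_hilbert \<times> 'k) set) \<Rightarrow> bool"
  where "Lagrangian_path I L \<longleftrightarrow>
    (\<forall>t\<in>I. Lagrangian (L t)) \<and> continuous_on I (\<lambda>t. orth_proj (L t))"

definition differentiable_path :: "real set \<Rightarrow> (real \<Rightarrow> ('k :: fd_complex_hilbert \<times> 'k) set) \<Rightarrow> bool"
  where "differentiable_path I L \<longleftrightarrow> (\<lambda>t. orth_proj (L t)) differentiable_on I"

text \<open>
  The lift \<open>v'\<close> of \<open>v\<close> plays the role of an arbitrary differentiable path through \<open>v\<close> in the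
  planes \<open>L t\<close>; the value is meaningful where \<open>L\<close> is differentiable and \<open>u\<close>, \<open>v\<close> lie in \<open>L t0\<close>.
\<close>

definition crossing_form ::
    "(real \<Rightarrow> ('k :: fd_complex_hilbert \<times> 'k) set) \<Rightarrow> real \<Rightarrow> 'k \<times> 'k \<Rightarrow> 'k \<times> 'k \<Rightarrow> complex" where
  "crossing_form L t0 u v = (THE q. \<exists>v'. v' t0 = v \<and>
     (\<forall>\<^sub>F t in nhds t0. v' t \<in> L t \<and> v' differentiable (at t)) \<and>
     ((\<lambda>t. omega u (v' t)) has_vector_derivative q) (at t0))"

text \<open>
  Definiteness is only used for Hermitian forms, whose diagonal values are real; taking real parts
  just turns these values into real numbers.
\<close>

definition positive_definite_on :: "'a :: zero set \<Rightarrow> ('a \<Rightarrow> 'a \<Rightarrow> complex) \<Rightarrow> bool" where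
  "positive_definite_on S q \<longleftrightarrow> (\<forall>u\<in>S. u \<noteq> 0 \<longrightarrow> Re (q u u) > 0)"

definition negative_definite_on :: "'a :: zero set \<Rightarrow> ('a \<Rightarrow> 'a \<Rightarrow> complex) \<Rightarrow> bool" where
  "negative_definite_on S q \<longleftrightarrow> (\<forall>u\<in>S. u \<noteq> 0 \<longrightarrow> Re (q u u) < 0)"

definition increasing_path :: "real set \<Rightarrow> (real \<Rightarrow> ('k :: fd_complex_hilbert \<times> 'k) set) \<Rightarrow> bool"
  where "increasing_path I L \<longleftrightarrow> (\<forall>t\<in>I. positive_definite_on (L t) (crossing_form L t))"


section \<open>The Duistermaat index\<close>

definition neg_index :: "'a :: fd_complex_hilbert set \<Rightarrow> ('a \<Rightarrow> 'a \<Rightarrow> complex) \<Rightarrow> nat" where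
  "neg_index A q = Max {cdim S | S. csubspace S \<and> S \<subseteq> A \<and> negative_definite_on S q}"

text \<open>The maximum is taken over a finite nonempty set:\<close>

lemma neg_index_wf:
  fixes A :: "'a :: fd_complex_hilbert set"
  assumes "csubspace A"
  shows "finite {cdim S | S. csubspace S \<and> S \<subseteq> A \<and> negative_definite_on S q}"
    and "{cdim S | S. csubspace S \<and> S \<subseteq> A \<and> negative_definite_on S q} \<noteq> {}"
proof -
  obtain C :: "'a set" where C: "finite C" "cspan C = UNIV"
    using finite_cspan by blast
  have "cdim S \<le> card C" for S :: "'a set"
    using complex_vector.dim_le_card[of S C] C by auto
  then show "finite {cdim S | S. csubspace S \<and> S \<subseteq> A \<and> negative_definite_on S q}"
    by (intro finite_subset[OF _ finite_atMost[of "card C"]]) auto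
  have "csubspace {0} \<and> {0} \<subseteq> A \<and> negative_definite_on {0} q"
    using complex_vector.subspace_0[OF assms] complex_vector.subspace_single_0
    by (auto simp: negative_definite_on_def)
  then show "{cdim S | S. csubspace S \<and> S \<subseteq> A \<and> negative_definite_on S q} \<noteq> {}"
    by blast
qed

text \<open>The map from \<open>\<alpha>\<close> to \<open>\<beta>\<close> whose graph is \<open>\<gamma>\<close>, when \<open>\<alpha> \<inter> \<beta> = 0 = \<beta> \<inter> \<gamma>\<close>:\<close>

definition graph_map :: "'a :: fd_complex_hilbert set \<Rightarrow> 'a set \<Rightarrow> 'a set \<Rightarrow> 'a \<Rightarrow> 'a" where
  "graph_map \<alpha> \<beta> \<gamma> u = (THE w. w \<in> \<beta> \<and> u + w \<in> \<gamma>)"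

definition Qform :: "('k :: fd_complex_hilbert \<times> 'k) set \<Rightarrow> ('k \<times> 'k) set \<Rightarrow> ('k \<times> 'k) set
    \<Rightarrow> 'k \<times> 'k \<Rightarrow> 'k \<times> 'k \<Rightarrow> complex" where
  "Qform \<alpha> \<beta> \<gamma> u1 u2 = omega u1 (graph_map \<alpha> \<beta> \<gamma> u2)"

text \<open>
  \<open>M\<close> is the auxiliary plane transversal to all three arguments. One always exists, and the index
  does not depend on it.
\<close>

definition duistermaat_index ::
    "('k :: fd_complex_hilbert \<times> 'k) set \<Rightarrow> ('k \<times> 'k) set \<Rightarrow> ('k \<times> 'k) set \<Rightarrow> int" where
  "duistermaat_index L1 L2 L3 =
    (let M = (SOME M. Lagrangian M \<and> L1 \<inter> M = {0} \<and> L2 \<inter> M = {0} \<and> L3 \<inter> M = {0})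
     in int (neg_index L2 (Qform L2 M L3)) - int (neg_index L1 (Qform L1 M L3))
        + int (neg_index L1 (Qform L1 M L2)))"

end

theory Submission
  imports Defs
begin

text \<open>
  The Duistermaat index does not depend on the auxiliary plane \<open>M\<close>: in the chart of planes
  transversal to \<open>M\<close>, the Kashiwara form
  \<open>\<omega>(u\<^sub>1, u\<^sub>2) + \<omega>(u\<^sub>2, u\<^sub>3) + \<omega>(u\<^sub>3, u\<^sub>1)\<close> on \<open>L1 \<times> L2 \<times> L3\<close>, which does not involve
  \<open>M\<close>, is congruent to the direct sum of \<open>Q(L1, M; L2)\<close>, \<open>Q(L2, M; L3)\<close> and \<open>- Q(L1, M; L3)\<close>,
  and Sylvester's law turns its negative index into the index plus terms free of \<open>M\<close>. One may
  therefore fix a single \<open>M\<close> transversal to the given planes, \<open>L 0\<close>, and hence to \<open>L t\<close> for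
  small \<open>t\<close>. On a fixed plane \<open>\<alpha>\<close> the forms \<open>Q(\<alpha>, M; L t)\<close> are continuous in \<open>t\<close> with the crossing
  form as derivative, so they are strictly increasing, and at \<open>t = 0\<close> the whole kernel
  \<open>\<alpha> \<inter> L 0\<close> passes from negative to positive.
\<close>

section \<open>Complex dimension\<close>

text \<open>The path need not be differentiable at 0, so no crossing form is available there. Strict
  monotonicity is therefore proved on each side separately, from positive derivatives on an open
  interval and continuity up to 0. The exact count is a squeeze: for f(t) = Q(\<alpha>, M; L t),
  monotonicity bounds the negative index of f(t) (for t < 0) or of -f(t) (for t > 0) below by its
  value at 0 plus dim(\<alpha> \<inter> L 0), semicontinuity bounds the other one below by its value
  at 0, and the two indices and dim(\<alpha> \<inter> L t) always add up to dim \<alpha>. A second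
  obstacle is that smoothness is assumed of orthogonal projections, whereas the forms involve
  projections along M; a linear equation with an invertible operator connects the two.\<close>

definition cbasis :: "'a::fd_complex_hilbert set" where
  "cbasis = (SOME B. finite B \<and> \<not> cdependent B \<and> cspan B = UNIV)"

lemma cbasis: "finite (cbasis :: 'a::fd_complex_hilbert set)" "\<not> cdependent (cbasis :: 'a set)"
  "cspan (cbasis :: 'a set) = UNIV"
proof -
  obtain B :: "'a set" where "B \<subseteq> UNIV" "\<not> cdependent B" "UNIV \<subseteq> cspan B"
    using complex_vector.maximal_independent_subset[of UNIV] by metis
  then have "finite B \<and> \<not> cdependent B \<and> cspan B = UNIV"
    using finite_cindependent by auto
  then have "finite (cbasis :: 'a set) \<and> \<not> cdependent (cbasis :: 'a set) \<and> cspan (cbasis :: 'a set) = UNIV"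
    unfolding cbasis_def by (rule someI)
  then show "finite (cbasis :: 'a set)" "\<not> cdependent (cbasis :: 'a set)" "cspan (cbasis :: 'a set) = UNIV"
    by auto
qed

text \<open>The locale takes a basis as a parameter, which \<open>cbasis\<close> supplies; the
  rewrites state its theorems with the constants already in use.\<close>

global_interpretation cfd: finite_dimensional_vector_space
  "scaleC :: complex \<Rightarrow> 'a \<Rightarrow> 'a::fd_complex_hilbert" cbasis
  rewrites "module.subspace (scaleC :: complex \<Rightarrow> 'a \<Rightarrow> 'a) = csubspace"
    and "module.span (scaleC :: complex \<Rightarrow> 'a \<Rightarrow> 'a) = cspan"
    and "module.dependent (scaleC :: complex \<Rightarrow> 'a \<Rightarrow> 'a) = cdependent"
    and "vector_space.dim (scaleC :: complex \<Rightarrow> 'a \<Rightarrow> 'a) = cdim"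
  by unfold_locales
    (use cbasis in \<open>auto simp: csubspace_def cspan_def cdependent_def cdim_def\<close>)

abbreviation clinear :: "('a::fd_complex_hilbert \<Rightarrow> 'b::fd_complex_hilbert) \<Rightarrow> bool" where
  "clinear \<equiv> Vector_Spaces.linear scaleC scaleC"

lemma clinearI:
  fixes f :: "'a::fd_complex_hilbert \<Rightarrow> 'b::fd_complex_hilbert"
  assumes "\<And>x y. f (x + y) = f x + f y" "\<And>c x. f (c *\<^sub>C x) = c *\<^sub>C f x"
  shows "clinear f"
  by unfold_locales (use assms in auto)

lemma clinear_add: "clinear f \<Longrightarrow> f (x + y) = f x + f y"
  and clinear_scale: "clinear f \<Longrightarrow> f (c *\<^sub>C x) = c *\<^sub>C f x"
  for f :: "'a::fd_complex_hilbert \<Rightarrow> 'b::fd_complex_hilbert"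
  by (simp_all add: Vector_Spaces.linear_iff)

lemma cdim_image:
  fixes f :: "'a::fd_complex_hilbert \<Rightarrow> 'b::fd_complex_hilbert"
  assumes "clinear f" "csubspace S" "inj_on f S"
  shows "cdim (f ` S) = cdim S"
proof -
  interpret finite_dimensional_vector_space_pair "scaleC :: complex \<Rightarrow> 'a \<Rightarrow> 'a" cbasis
    "scaleC :: complex \<Rightarrow> 'b \<Rightarrow> 'b" cbasis
    by unfold_locales
  show ?thesis
    using dim_image_eq[OF assms(1), of S] assms complex_vector.span_eq_iff[of S]
    by (simp add: cspan_def cdim_def)
qed

lemma csubspace_image:
  fixes f :: "'a::fd_complex_hilbert \<Rightarrow> 'b::fd_complex_hilbert"
  assumes "clinear f" "csubspace S"
  shows "csubspace (f ` S)"
  using module_hom.subspace_image[of scaleC scaleC f S] assms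
  by (simp add: csubspace_def module_hom_iff_linear)

lemma csubspace_plus:
  assumes "csubspace S" "csubspace T"
  shows "csubspace {x + y |x y. x \<in> S \<and> y \<in> T}"
  by (rule complex_vector.subspace_sums[OF assms])

lemma cdim_plus_disjoint:
  assumes "csubspace S" "csubspace T" "S \<inter> T \<subseteq> {0}"
  shows "cdim {x + y |x y. x \<in> S \<and> y \<in> T} = cdim S + cdim T"
  using cfd.dim_sums_Int[OF assms(1,2)] cfd.dim_eq_0[of "S \<inter> T"] assms(3) by linarith

lemma cdim_disjoint_le:
  assumes "csubspace V" "csubspace S" "csubspace T" "S \<subseteq> V" "T \<subseteq> V" "S \<inter> T \<subseteq> {0}"
  shows "cdim S + cdim T \<le> cdim V"
proof -
  have "{x + y |x y. x \<in> S \<and> y \<in> T} \<subseteq> V"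
    using assms(4,5) complex_vector.subspace_add[OF assms(1)] by auto
  then have "cdim {x + y |x y. x \<in> S \<and> y \<in> T} \<le> cdim V"
    by (rule cfd.dim_subset)
  then show ?thesis
    unfolding cdim_plus_disjoint[OF assms(2,3,6)] .
qed

lemma cdim_complement:
  assumes "csubspace K" "csubspace V" "K \<subseteq> V"
  obtains T where "csubspace T" "T \<subseteq> V" "K \<inter> T = {0}" "cdim K + cdim T = cdim V"
proof -
  obtain B where B: "B \<subseteq> K" "\<not> cdependent B" "K \<subseteq> cspan B"
    using complex_vector.maximal_independent_subset[of K] by metis
  then obtain C where C: "B \<subseteq> C" "C \<subseteq> V" "\<not> cdependent C" "V \<subseteq> cspan C"
    using complex_vector.maximal_independent_subset_extend[of B V] assms by (metis order_trans)
  have fin: "finite C" using C finite_cindependent by blast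
  have iD: "\<not> cdependent (C - B)"
    using C complex_vector.dependent_mono[of "C - B" C] by auto
  have K: "cspan B = K" using B assms complex_vector.span_subspace by blast
  have V: "cspan C = V" using C assms complex_vector.span_subspace by blast
  have dims: "cdim K = card B" "cdim V = card C" "cdim (cspan (C - B)) = card (C - B)"
    using complex_vector.dim_span_eq_card_independent[OF B(2)] complex_vector.dim_span_eq_card_independent[OF C(3)]
      complex_vector.dim_span_eq_card_independent[OF iD] K V by auto
  have sum: "card B + card (C - B) = card C"
    using fin C(1) by (metis card_Diff_subset card_mono finite_subset le_add_diff_inverse)
  have "{x + y |x y. x \<in> cspan B \<and> y \<in> cspan (C - B)} = cspan C"
    using complex_vector.span_Un[of B "C - B"] C(1) by (auto simp: Un_absorb1)
  then have "cdim (K \<inter> cspan (C - B)) = 0"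
    using cfd.dim_sums_Int[of K "cspan (C - B)"] assms(1) sum dims K V by auto
  then have "K \<inter> cspan (C - B) = {0}"
    using complex_vector.subspace_0[OF assms(1)] complex_vector.span_zero by (auto simp: cfd.dim_eq_0)
  moreover have "cspan (C - B) \<subseteq> V" using V complex_vector.span_mono by blast
  ultimately show ?thesis using that[of "cspan (C - B)"] dims sum by auto
qed

text \<open>If \<phi> v is nonzero, subtracting a multiple of v moves any vector into the kernel.
  Linearity is asked on V alone, since the functionals in question come from forms given on a
  subspace.\<close>

lemma cdim_hyperplane:
  fixes \<phi> :: "'a::fd_complex_hilbert \<Rightarrow> complex"
  assumes V: "csubspace V"
    and add: "\<And>x y. x \<in> V \<Longrightarrow> y \<in> V \<Longrightarrow> \<phi> (x + y) = \<phi> x + \<phi> y"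
    and scale: "\<And>c x. x \<in> V \<Longrightarrow> \<phi> (c *\<^sub>C x) = c * \<phi> x"
  shows "csubspace {v \<in> V. \<phi> v = 0}" "cdim V \<le> cdim {v \<in> V. \<phi> v = 0} + 1"
proof -
  let ?H = "{v \<in> V. \<phi> v = 0}"
  have "\<phi> 0 = 0"
    using scale[of 0 0] complex_vector.subspace_0[OF V] by simp
  then show "csubspace ?H"
    using V by (auto simp: complex_vector.subspace_def add scale)
  show "cdim V \<le> cdim ?H + 1"
  proof (cases "\<exists>v\<in>V. \<phi> v \<noteq> 0")
    case True
    then obtain v where v: "v \<in> V" "\<phi> v \<noteq> 0" by blast
    have "V \<subseteq> cspan (insert v ?H)"
    proof
      fix x assume x: "x \<in> V"
      define c where "c = \<phi> x / \<phi> v"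
      have "x - c *\<^sub>C v \<in> V"
        using x v V by (intro complex_vector.subspace_diff complex_vector.subspace_scale)
      moreover have "\<phi> (x - c *\<^sub>C v) = 0"
        using add[OF \<open>x - c *\<^sub>C v \<in> V\<close>, of "c *\<^sub>C v"] v scale[OF v(1)]
          complex_vector.subspace_scale[OF V v(1)] by (simp add: c_def)
      ultimately have "x - c *\<^sub>C v \<in> cspan ?H"
        by (intro complex_vector.span_base) simp
      then show "x \<in> cspan (insert v ?H)"
        using complex_vector.span_breakdown_eq by blast
    qed
    then have "cdim V \<le> cdim (insert v ?H)" by (rule cfd.dim_mono)
    then show ?thesis by (simp add: cfd.dim_insert split: if_splits)
  next
    case False
    then have "?H = V" by auto
    then show ?thesis by simp
  qed
qed

text \<open>Each equation costs at most one dimension. With \<phi> b = q b for b in a basis of a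
  subspace, this bounds the q-orthogonal complement from below even if q is degenerate.\<close>

lemma cdim_joint_kernel:
  fixes \<phi> :: "'b \<Rightarrow> 'a::fd_complex_hilbert \<Rightarrow> complex"
  assumes "finite B" and V: "csubspace V"
    and add: "\<And>b x y. b \<in> B \<Longrightarrow> x \<in> V \<Longrightarrow> y \<in> V \<Longrightarrow> \<phi> b (x + y) = \<phi> b x + \<phi> b y"
    and scale: "\<And>b c x. b \<in> B \<Longrightarrow> x \<in> V \<Longrightarrow> \<phi> b (c *\<^sub>C x) = c * \<phi> b x"
  shows "csubspace {v \<in> V. \<forall>b\<in>B. \<phi> b v = 0} \<and> cdim V \<le> cdim {v \<in> V. \<forall>b\<in>B. \<phi> b v = 0} + card B"
  using assms(1) add scale
proof (induction B)
  case empty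
  then show ?case using V by simp
next
  case (insert b B)
  let ?H = "{v \<in> V. \<forall>b\<in>B. \<phi> b v = 0}"
  have IH: "csubspace ?H" "cdim V \<le> cdim ?H + card B" using insert by auto
  have "{v \<in> V. \<forall>b\<in>insert b B. \<phi> b v = 0} = {v \<in> ?H. \<phi> b v = 0}" by auto
  moreover have "csubspace {v \<in> ?H. \<phi> b v = 0}" "cdim ?H \<le> cdim {v \<in> ?H. \<phi> b v = 0} + 1"
    using insert.prems by (intro cdim_hyperplane IH; simp)+
  ultimately show ?case using IH insert.hyps by simp
qed

lemma cdim_Times:
  assumes "csubspace (A :: 'a::fd_complex_hilbert set)" "csubspace (B :: 'b::fd_complex_hilbert set)"
  shows "csubspace (A \<times> B)" "cdim (A \<times> B) = cdim A + cdim B"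
proof -
  let ?i = "\<lambda>a::'a. (a, 0::'b)" and ?j = "\<lambda>b::'b. (0::'a, b)"
  have lin: "clinear ?i" "clinear ?j" by (auto intro!: clinearI simp: scaleC_prod_def)
  show "csubspace (A \<times> B)"
    using assms by (auto simp: complex_vector.subspace_def scaleC_prod_def zero_prod_def)
  have "A \<times> B = {x + y |x y. x \<in> ?i ` A \<and> y \<in> ?j ` B}"
  proof (intro equalityI subsetI)
    fix z assume "z \<in> A \<times> B"
    then show "z \<in> {x + y |x y. x \<in> ?i ` A \<and> y \<in> ?j ` B}"
      by (intro CollectI exI[of _ "?i (fst z)"] exI[of _ "?j (snd z)"]) auto
  qed auto
  also have "cdim \<dots> = cdim (?i ` A) + cdim (?j ` B)"
    using assms lin by (intro cdim_plus_disjoint csubspace_image) (auto simp: zero_prod_def)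
  also have "\<dots> = cdim A + cdim B"
    using assms lin by (simp add: cdim_image inj_on_def)
  finally show "cdim (A \<times> B) = cdim A + cdim B" .
qed


section \<open>Inertia of Hermitian forms\<close>

lemma neg_index_attained:
  fixes V :: "'a::fd_complex_hilbert set"
  assumes "csubspace V"
  obtains S where "csubspace S" "S \<subseteq> V" "negative_definite_on S q" "cdim S = neg_index V q"
proof -
  have "neg_index V q \<in> {cdim S | S. csubspace S \<and> S \<subseteq> V \<and> negative_definite_on S q}"
    unfolding neg_index_def by (intro Max_in neg_index_wf assms)
  then show ?thesis using that by auto
qed

lemma neg_index_ge:
  fixes V :: "'a::fd_complex_hilbert set"
  assumes "csubspace V" "csubspace S" "S \<subseteq> V" "negative_definite_on S q"
  shows "cdim S \<le> neg_index V q"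
  unfolding neg_index_def using assms by (intro Max_ge neg_index_wf) auto

text \<open>A negative definite subspace meets T only in 0, so the two dimensions add up inside V.
  Upper bounds for the index are obtained this way, lower ones from
  \<open>neg_index_ge\<close>.\<close>

lemma neg_index_le:
  fixes V :: "'a::fd_complex_hilbert set"
  assumes "csubspace V" "csubspace T" "T \<subseteq> V" and nonneg: "\<And>x. x \<in> T \<Longrightarrow> Re (q x x) \<ge> 0"
  shows "neg_index V q + cdim T \<le> cdim V"
proof -
  obtain S where S: "csubspace S" "S \<subseteq> V" "negative_definite_on S q" "cdim S = neg_index V q"
    using neg_index_attained[OF assms(1)] by metis
  have "S \<inter> T \<subseteq> {0}"
    using S(3) nonneg by (force simp: negative_definite_on_def)
  then show ?thesis
    using cdim_disjoint_le[OF assms(1) S(1) assms(2) S(2) assms(3)] S(4) by simp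
qed

text \<open>The index sees only real parts of diagonal values, so only these are compared. This
  admits forms that are not Hermitian, such as the Kashiwara form below.\<close>

lemma neg_index_image:
  fixes f :: "'a::fd_complex_hilbert \<Rightarrow> 'b::fd_complex_hilbert"
  assumes f: "clinear f" "inj_on f A" and A: "csubspace A"
    and q: "\<And>u. u \<in> A \<Longrightarrow> Re (q' (f u) (f u)) = Re (q u u)"
  shows "neg_index (f ` A) q' = neg_index A q"
proof (rule antisym)
  have f0: "f 0 = 0" using clinear_scale[OF f(1), of 0 0] by simp
  have A0: "0 \<in> A" by (rule complex_vector.subspace_0[OF A])
  have f0': "f u = 0 \<longleftrightarrow> u = 0" if "u \<in> A" for u
    using f(2) that A0 f0 by (metis inj_onD)
  have fA: "csubspace (f ` A)" using csubspace_image f A by blast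
  obtain S where S: "csubspace S" "S \<subseteq> A" "negative_definite_on S q" "cdim S = neg_index A q"
    using neg_index_attained[OF A] by metis
  have "negative_definite_on (f ` S) q'"
    using S q f0' unfolding negative_definite_on_def by auto
  then have "cdim (f ` S) \<le> neg_index (f ` A) q'"
    using S fA csubspace_image[OF f(1) S(1)] by (intro neg_index_ge) auto
  then show "neg_index A q \<le> neg_index (f ` A) q'"
    using cdim_image[OF f(1) S(1)] S inj_on_subset[OF f(2)] by simp
  obtain S where S: "csubspace S" "S \<subseteq> f ` A" "negative_definite_on S q'" "cdim S = neg_index (f ` A) q'"
    using neg_index_attained[OF fA] by metis
  define T where "T = {u \<in> A. f u \<in> S}"
  have T: "csubspace T"
    using A S(1) f0 unfolding T_def complex_vector.subspace_def
    by (auto simp: clinear_add[OF f(1)] clinear_scale[OF f(1)])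
  have TA: "T \<subseteq> A" and fT: "f ` T = S" using S(2) by (auto simp: T_def)
  have "negative_definite_on T q"
    using S q f0' unfolding negative_definite_on_def T_def by fastforce
  then have "cdim T \<le> neg_index A q"
    using T A by (intro neg_index_ge) (auto simp: T_def)
  moreover have "cdim S = cdim T"
    using cdim_image[OF f(1) T] inj_on_subset[OF f(2) TA] fT by simp
  ultimately show "neg_index (f ` A) q' \<le> neg_index A q" using S by simp
qed

text \<open>All laws are relative to V because the forms to come are Hermitian only on their own
  plane.\<close>

locale hermitian_form =
  fixes V :: "'a::fd_complex_hilbert set" and q :: "'a \<Rightarrow> 'a \<Rightarrow> complex"
  assumes subspace: "csubspace V"
    and add_right: "\<lbrakk>u \<in> V; v \<in> V; w \<in> V\<rbrakk> \<Longrightarrow> q u (v + w) = q u v + q u w"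
    and scale_right: "\<lbrakk>u \<in> V; v \<in> V\<rbrakk> \<Longrightarrow> q u (c *\<^sub>C v) = c * q u v"
    and herm: "\<lbrakk>u \<in> V; v \<in> V\<rbrakk> \<Longrightarrow> q u v = cnj (q v u)"
begin

lemma V_add: "u \<in> V \<Longrightarrow> v \<in> V \<Longrightarrow> u + v \<in> V"
  and V_scale: "u \<in> V \<Longrightarrow> c *\<^sub>C u \<in> V"
  and V_zero: "0 \<in> V"
  using subspace by (auto simp: complex_vector.subspace_def)

lemma add_left: "\<lbrakk>u \<in> V; v \<in> V; w \<in> V\<rbrakk> \<Longrightarrow> q (u + v) w = q u w + q v w"
  using add_right[of w u v] herm[of "u + v" w] herm[of u w] herm[of v w] V_add by simp

lemma scale_left: "\<lbrakk>u \<in> V; v \<in> V\<rbrakk> \<Longrightarrow> q (c *\<^sub>C u) v = cnj c * q u v"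
  using scale_right[of v u c] herm[of "c *\<^sub>C u" v] herm[of u v] V_scale by simp

lemma zero_right: "u \<in> V \<Longrightarrow> q u 0 = 0"
  using scale_right[of u 0 0] V_zero by simp

lemma eq_0_sym: "u \<in> V \<Longrightarrow> v \<in> V \<Longrightarrow> q u v = 0 \<Longrightarrow> q v u = 0"
  using herm[of u v] by simp

lemma quadratic_add:
  assumes "u \<in> V" "v \<in> V"
  shows "Re (q (u + v) (u + v)) = Re (q u u) + 2 * Re (q u v) + Re (q v v)"
proof -
  have "q (u + v) (u + v) = q u u + q u v + (q v u + q v v)"
    using assms by (simp add: add_left add_right V_add)
  moreover have "Re (q v u) = Re (q u v)" using herm[of u v] assms by simp
  ultimately show ?thesis by simp
qed

lemma quadratic_scale:
  assumes "u \<in> V"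
  shows "Re (q (c *\<^sub>C u) (c *\<^sub>C u)) = (cmod c)\<^sup>2 * Re (q u u)"
proof -
  have "q (c *\<^sub>C u) (c *\<^sub>C u) = (c * cnj c) * q u u"
    using assms V_scale by (simp add: scale_left scale_right)
  also have "c * cnj c = complex_of_real ((cmod c)\<^sup>2)"
    by (rule complex_norm_square[symmetric])
  finally show ?thesis by (simp only: Re_complex_of_real times_complex.sel Im_complex_of_real)
qed

text \<open>Adding c x to y changes the quadratic value only by the cross term 2 Re (q y (c x)),
  which a suitable c makes arbitrarily negative unless q y x = 0.\<close>

lemma isotropic_orthogonal_of_nonneg:
  assumes T: "csubspace T" "T \<subseteq> V" "\<And>y. y \<in> T \<Longrightarrow> Re (q y y) \<ge> 0"
    and x: "x \<in> T" "Re (q x x) = 0" and y: "y \<in> T"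
  shows "q y x = 0"
proof (rule ccontr)
  assume ne: "q y x \<noteq> 0"
  \<comment> \<open>Chosen so that the cross term is -2 (Re (q y y) + 1), which brings the value at
    y + c x down to -Re (q y y) - 2 < 0.\<close>
  define k where "k = (Re (q y y) + 1) / (cmod (q y x))\<^sup>2"
  define c where "c = - complex_of_real k * cnj (q y x)"
  have V: "x \<in> V" "y \<in> V" using x y T by auto
  have cx: "c *\<^sub>C x \<in> T" using x complex_vector.subspace_scale[OF T(1)] by blast
  have "Re (q (c *\<^sub>C x) (c *\<^sub>C x)) = 0" using x V by (simp add: quadratic_scale)
  moreover have "q y (c *\<^sub>C x) = - (complex_of_real k * (q y x * cnj (q y x)))"
    using V by (simp only: scale_right c_def) simp
  then have "Re (q y (c *\<^sub>C x)) = - (k * (cmod (q y x))\<^sup>2)"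
    by (simp add: cmod_power2) (simp add: power2_eq_square)
  moreover have "k * (cmod (q y x))\<^sup>2 = Re (q y y) + 1" using ne by (simp add: k_def)
  ultimately have "Re (q (y + c *\<^sub>C x) (y + c *\<^sub>C x)) = Re (q y y) - 2 * (Re (q y y) + 1)"
    using V V_scale by (subst quadratic_add) auto
  moreover have "Re (q (y + c *\<^sub>C x) (y + c *\<^sub>C x)) \<ge> 0"
    using T y cx complex_vector.subspace_add[OF T(1)] by blast
  ultimately show False using T(3)[OF y] by simp
qed

text \<open>S is negative definite of maximal dimension and T is its q-orthogonal complement. The
  last clause, that T is the whole complement, serves to place the kernel inside T.\<close>

lemma sylvester_decomposition:
  obtains S T where "csubspace S" "S \<subseteq> V" "negative_definite_on S q" "cdim S = neg_index V q"
    "csubspace T" "T \<subseteq> V" "\<And>x. x \<in> T \<Longrightarrow> Re (q x x) \<ge> 0" "cdim S + cdim T = cdim V"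
    "\<And>s t. s \<in> S \<Longrightarrow> t \<in> T \<Longrightarrow> q s t = 0" "V = {s + t |s t. s \<in> S \<and> t \<in> T}"
    "\<And>v. v \<in> V \<Longrightarrow> (\<And>s. s \<in> S \<Longrightarrow> q s v = 0) \<Longrightarrow> v \<in> T"
proof -
  obtain S where S: "csubspace S" "S \<subseteq> V" "negative_definite_on S q" "cdim S = neg_index V q"
    using neg_index_attained[OF subspace] by metis
  obtain B where B: "B \<subseteq> S" "\<not> cdependent B" "S \<subseteq> cspan B" "card B = cdim S"
    using complex_vector.basis_exists[of S] by metis
  have finB: "finite B" using B finite_cindependent by blast
  \<comment> \<open>Testing against a basis of S leaves \<open>card B\<close> equations, so that dim
    T is at least dim V - dim S.\<close>
  define T where "T = {v \<in> V. \<forall>b\<in>B. q b v = 0}"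
  have BV: "b \<in> V" if "b \<in> B" for b using that B S by auto
  have T: "csubspace T" "cdim V \<le> cdim T + card B"
    using cdim_joint_kernel[OF finB subspace, of q] BV add_right scale_right
    unfolding T_def by auto
  have TV: "T \<subseteq> V" by (auto simp: T_def)
  have orth: "q s t = 0" if "s \<in> S" "t \<in> T" for s t
  proof -
    have "csubspace {u \<in> V. q t u = 0}"
      using that TV by (intro cdim_hyperplane subspace add_right scale_right) auto
    moreover have "B \<subseteq> {u \<in> V. q t u = 0}"
      using that BV by (auto simp: T_def intro: eq_0_sym)
    ultimately have "cspan B \<subseteq> {u \<in> V. q t u = 0}"
      by (rule complex_vector.span_minimal[rotated])
    then show ?thesis using that B S TV eq_0_sym by blast
  qed
  have disj: "S \<inter> T \<subseteq> {0}"
  proof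
    fix x assume x: "x \<in> S \<inter> T"
    then have "q x x = 0" using orth by blast
    then show "x \<in> {0}" using x S(3) by (force simp: negative_definite_on_def)
  qed
  \<comment> \<open>A negative vector in T would be orthogonal to S and could be adjoined to it,
    against the maximality of S.\<close>
  have nonneg: "Re (q x x) \<ge> 0" if x: "x \<in> T" for x
  proof (rule ccontr)
    assume neg: "\<not> 0 \<le> Re (q x x)"
    have xV: "x \<in> V" using x TV by auto
    have q0: "q 0 0 = 0" using zero_right V_zero by blast
    have x0: "x \<noteq> 0" using neg q0 by auto
    have xS: "x \<notin> S" using x disj x0 by auto
    have "negative_definite_on (cspan (insert x S)) q"
      unfolding negative_definite_on_def
    proof (intro ballI impI)
      fix u assume "u \<in> cspan (insert x S)" and u0: "u \<noteq> 0"
      then obtain c where "u - c *\<^sub>C x \<in> cspan S"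
        using complex_vector.span_breakdown_eq by blast
      then have s: "u - c *\<^sub>C x \<in> S"
        using S(1) complex_vector.span_eq_iff by blast
      define s where "s = u - c *\<^sub>C x"
      have u: "u = s + c *\<^sub>C x" by (simp add: s_def)
      have sS: "s \<in> S" "s \<in> V" using s S(2) by (auto simp: s_def)
      have "Re (q u u) = Re (q s s) + (cmod c)\<^sup>2 * Re (q x x)"
      proof -
        have "q s (c *\<^sub>C x) = 0" using orth[OF sS(1) x] sS xV by (simp add: scale_right)
        then show ?thesis
          unfolding u using sS xV V_scale by (simp add: quadratic_add quadratic_scale)
      qed
      moreover have "Re (q s s) \<le> 0"
        using S(3) sS q0 unfolding negative_definite_on_def by (cases "s = 0") (auto simp: less_imp_le)
      moreover have "Re (q s s) < 0" if "c = 0"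
        using S(3) sS u0 u that unfolding negative_definite_on_def by simp
      moreover have "(cmod c)\<^sup>2 * Re (q x x) < 0" if "c \<noteq> 0"
        using that neg by (simp add: mult_pos_neg)
      ultimately show "Re (q u u) < 0" by (cases "c = 0") auto
    qed
    then have "cdim (cspan (insert x S)) \<le> neg_index V q"
      using S(2) xV by (intro neg_index_ge subspace complex_vector.span_minimal) auto
    moreover have "x \<notin> cspan S" using xS S(1) complex_vector.span_eq_iff by blast
    ultimately show False using S(4) by (simp add: cfd.dim_insert)
  qed
  have dims: "cdim S + cdim T = cdim V"
    using T(2) B(4) neg_index_le[OF subspace T(1) TV, of q] nonneg S(4) by simp
  have "{s + t |s t. s \<in> S \<and> t \<in> T} \<subseteq> V" using S(2) TV V_add by auto
  moreover have "cdim V \<le> cdim {s + t |s t. s \<in> S \<and> t \<in> T}"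
    using cdim_plus_disjoint[OF S(1) T(1) disj] dims by simp
  ultimately have "V = {s + t |s t. s \<in> S \<and> t \<in> T}"
    using cfd.subspace_dim_equal[OF csubspace_plus[OF S(1) T(1)] subspace] by simp
  moreover have "v \<in> T" if "v \<in> V" "\<And>s. s \<in> S \<Longrightarrow> q s v = 0" for v
    using that B(1) by (auto simp: T_def)
  ultimately show ?thesis
    using that[OF S T(1) TV nonneg dims orth] by blast
qed

definition kernel where "kernel = {v \<in> V. \<forall>u\<in>V. q u v = 0}"

lemma kernel_subspace: "csubspace kernel"
  using subspace zero_right unfolding kernel_def
  by (auto simp: complex_vector.subspace_def add_right scale_right)

lemma hermitian_uminus: "hermitian_form V (\<lambda>u v. - q u v)"
  by unfold_locales (auto simp: subspace add_right scale_right intro: herm)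

text \<open>The second part yields a nonpositive subspace that includes the kernel; a strictly
  smaller form is negative definite on all of it, which is how the kernel gets counted along a
  monotone path.\<close>

lemma inertia:
  "neg_index V q + neg_index V (\<lambda>u v. - q u v) + cdim kernel = cdim V"
  "\<exists>P. csubspace P \<and> P \<subseteq> V \<and> (\<forall>x\<in>P. Re (q x x) \<le> 0) \<and> cdim P = neg_index V q + cdim kernel"
proof -
  obtain S T where ST: "csubspace S" "S \<subseteq> V" "negative_definite_on S q" "cdim S = neg_index V q"
    "csubspace T" "T \<subseteq> V" "\<And>x. x \<in> T \<Longrightarrow> Re (q x x) \<ge> 0" "cdim S + cdim T = cdim V"
    and orth: "\<And>s t. s \<in> S \<Longrightarrow> t \<in> T \<Longrightarrow> q s t = 0" and V: "V = {s + t |s t. s \<in> S \<and> t \<in> T}"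
    and TI: "\<And>v. v \<in> V \<Longrightarrow> (\<And>s. s \<in> S \<Longrightarrow> q s v = 0) \<Longrightarrow> v \<in> T"
    by (rule sylvester_decomposition) blast
  have RT: "kernel \<subseteq> T" using ST(2) by (auto simp: kernel_def intro: TI)
  \<comment> \<open>In T a null vector is orthogonal to T by
    \<open>isotropic_orthogonal_of_nonneg\<close> and to S by construction, hence lies in the
    kernel. So q is positive definite on a complement of the kernel in T.\<close>
  obtain P where P: "csubspace P" "P \<subseteq> T" "kernel \<inter> P = {0}" "cdim kernel + cdim P = cdim T"
    using cdim_complement[OF kernel_subspace ST(5) RT] by metis
  have "negative_definite_on P (\<lambda>u v. - q u v)"
    unfolding negative_definite_on_def
  proof (intro ballI impI)
    fix x assume x: "x \<in> P" "x \<noteq> 0"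
    have xT: "x \<in> T" "x \<in> V" using x P ST by auto
    have "Re (q x x) \<noteq> 0"
    proof
      assume 0: "Re (q x x) = 0"
      have "q u x = 0" if "u \<in> V" for u
      proof -
        obtain s t where u: "u = s + t" "s \<in> S" "t \<in> T" using \<open>u \<in> V\<close> V by auto
        have "q t x = 0"
          using isotropic_orthogonal_of_nonneg[OF ST(5,6,7) xT(1) 0 u(3)] by blast
        then show ?thesis using u orth[OF u(2) xT(1)] ST xT by (auto simp: add_left subset_iff)
      qed
      then have "x \<in> kernel" using xT by (simp add: kernel_def)
      then show False using x P by blast
    qed
    then show "Re (- q x x) < 0" using ST(7)[OF xT(1)] by simp
  qed
  then have ge: "cdim P \<le> neg_index V (\<lambda>u v. - q u v)"
    using P ST by (intro neg_index_ge subspace) auto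
  \<comment> \<open>S plus the kernel is nonpositive: it bounds the index of -q from above, and it
    is the witness for the second claim.\<close>
  let ?N = "{s + t |s t. s \<in> S \<and> t \<in> kernel}"
  have N: "csubspace ?N" using csubspace_plus[OF ST(1) kernel_subspace] .
  have NV: "?N \<subseteq> V" using ST(2) V_add by (auto simp: kernel_def)
  have q0: "q 0 0 = 0" using zero_right V_zero by blast
  have Nq: "Re (q x x) \<le> 0" if "x \<in> ?N" for x
  proof -
    obtain s t where x: "x = s + t" "s \<in> S" "t \<in> kernel" using \<open>x \<in> ?N\<close> by blast
    have st: "s \<in> V" "t \<in> V" using x ST by (auto simp: kernel_def)
    have "q s t = 0" "q t t = 0" using x st by (auto simp: kernel_def)
    moreover have "Re (q s s) \<le> 0"
      using ST(3) x(2) q0 unfolding negative_definite_on_def by (cases "s = 0") (auto simp: less_imp_le)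
    ultimately show ?thesis using x st by (simp add: quadratic_add)
  qed
  have "S \<inter> kernel \<subseteq> {0}"
  proof
    fix x assume x: "x \<in> S \<inter> kernel"
    then have "q x x = 0" using ST(2) by (auto simp: kernel_def)
    then show "x \<in> {0}" using x ST(3) by (force simp: negative_definite_on_def)
  qed
  then have dN: "cdim ?N = cdim S + cdim kernel"
    by (rule cdim_plus_disjoint[OF ST(1) kernel_subspace])
  have "neg_index V (\<lambda>u v. - q u v) + cdim ?N \<le> cdim V"
    using Nq by (intro neg_index_le subspace N NV) auto
  then show "neg_index V q + neg_index V (\<lambda>u v. - q u v) + cdim kernel = cdim V"
    using ge P(4) ST(4,8) dN by linarith
  show "\<exists>P. csubspace P \<and> P \<subseteq> V \<and> (\<forall>x\<in>P. Re (q x x) \<le> 0) \<and> cdim P = neg_index V q + cdim kernel"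
    using N NV Nq dN ST(4) by (intro exI[of _ ?N]) auto
qed

end

text \<open>The products of the negative parts and of the nonnegative parts have complementary
  dimensions, so the lower and upper bounds for the index agree.\<close>

lemma neg_index_Times:
  assumes "hermitian_form (A :: 'a::fd_complex_hilbert set) q"
    and "hermitian_form (B :: 'b::fd_complex_hilbert set) r"
  shows "neg_index (A \<times> B) (\<lambda>u v. q (fst u) (fst v) + r (snd u) (snd v)) = neg_index A q + neg_index B r"
    (is "neg_index _ ?h = _")
proof -
  obtain S T where A: "csubspace S" "S \<subseteq> A" "negative_definite_on S q" "cdim S = neg_index A q"
    "csubspace T" "T \<subseteq> A" "\<And>x. x \<in> T \<Longrightarrow> Re (q x x) \<ge> 0" "cdim S + cdim T = cdim A"
    by (rule hermitian_form.sylvester_decomposition[OF assms(1)]) blast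
  obtain S' T' where B: "csubspace S'" "S' \<subseteq> B" "negative_definite_on S' r" "cdim S' = neg_index B r"
    "csubspace T'" "T' \<subseteq> B" "\<And>x. x \<in> T' \<Longrightarrow> Re (r x x) \<ge> 0" "cdim S' + cdim T' = cdim B"
    by (rule hermitian_form.sylvester_decomposition[OF assms(2)]) blast
  have subs: "csubspace A" "csubspace B"
    using assms by (auto simp: hermitian_form_def)
  have "q 0 0 = 0" "r 0 0 = 0"
    using hermitian_form.zero_right[OF assms(1)] hermitian_form.V_zero[OF assms(1)]
      hermitian_form.zero_right[OF assms(2)] hermitian_form.V_zero[OF assms(2)] by auto
  then have nonpos: "Re (q x x) \<le> 0" if "x \<in> S" for x
    using A(3) that unfolding negative_definite_on_def by (cases "x = 0") (auto simp: less_imp_le)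
  have nonpos': "Re (r x x) \<le> 0" if "x \<in> S'" for x
    using B(3) \<open>r 0 0 = 0\<close> that unfolding negative_definite_on_def by (cases "x = 0") (auto simp: less_imp_le)
  have "negative_definite_on (S \<times> S') ?h"
    unfolding negative_definite_on_def
  proof (intro ballI impI)
    fix u assume u: "u \<in> S \<times> S'" "u \<noteq> 0"
    then have "fst u \<in> S" "snd u \<in> S'" "fst u \<noteq> 0 \<or> snd u \<noteq> 0" by (auto simp: prod_eq_iff)
    then show "Re (q (fst u) (fst u) + r (snd u) (snd u)) < 0"
      using A(3) B(3) nonpos nonpos' unfolding negative_definite_on_def
      by (metis add_neg_nonpos add_nonpos_neg plus_complex.sel(1))
  qed
  then have "cdim (S \<times> S') \<le> neg_index (A \<times> B) ?h"
    using A B subs by (intro neg_index_ge cdim_Times) auto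
  moreover have "neg_index (A \<times> B) ?h + cdim (T \<times> T') \<le> cdim (A \<times> B)"
    using A B subs by (intro neg_index_le cdim_Times) auto
  ultimately show ?thesis
    using A B subs by (simp add: cdim_Times)
qed


section \<open>Lagrangian planes and the choice of the auxiliary plane\<close>

lemma omega_add_left: "omega (u + v) w = omega u w + omega v w"
  and omega_add_right: "omega u (v + w) = omega u v + omega u w"
  and omega_diff_right: "omega u (v - w) = omega u v - omega u w"
  by (simp_all add: omega_def cinner_add_left cinner_add_right cinner_diff_right)

lemma omega_scale_right: "omega u (c *\<^sub>C v) = c * omega u v"
  by (simp add: omega_def scaleC_prod_def cinner_scaleC_right algebra_simps)

lemma omega_commute: "omega u v = - cnj (omega v u)"
  using cinner_commute[of "fst u" "snd v"] cinner_commute[of "snd u" "fst v"]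
  by (simp add: omega_def)

lemma omega_eq_0_commute: "omega u v = 0 \<longleftrightarrow> omega v u = 0"
  using omega_commute[of u v] by auto

lemma Lagrangian_csubspace: "Lagrangian L \<Longrightarrow> csubspace L"
  by (simp add: Lagrangian_def)

lemma Lagrangian_omega: "Lagrangian L \<Longrightarrow> u \<in> L \<Longrightarrow> v \<in> L \<Longrightarrow> omega u v = 0"
  unfolding Lagrangian_def by blast

lemma Lagrangian_memI: "Lagrangian L \<Longrightarrow> (\<And>v. v \<in> L \<Longrightarrow> omega u v = 0) \<Longrightarrow> u \<in> L"
  unfolding Lagrangian_def by blast

lemma Lagrangian_memI': "Lagrangian L \<Longrightarrow> (\<And>v. v \<in> L \<Longrightarrow> omega v u = 0) \<Longrightarrow> u \<in> L"
  by (rule Lagrangian_memI) (auto simp: omega_eq_0_commute[of u])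

text \<open>A vector orthogonal to L + M turns, under J(a, b) = (-b, a), into one that is
  symplectically orthogonal to both planes. It then lies in L \<inter> M and vanishes.\<close>

lemma Lagrangian_decompose:
  assumes L: "Lagrangian L" and M: "Lagrangian M" and LM: "L \<inter> M = {0}"
  obtains l m where "l \<in> L" "m \<in> M" "u = l + m"
proof -
  let ?S = "{l + m |l m. l \<in> L \<and> m \<in> M}"
  have S: "csubspace ?S" using L M by (intro csubspace_plus Lagrangian_csubspace)
  obtain v where v: "v \<in> ?S" "\<And>w. w \<in> ?S \<Longrightarrow> cinner w (u - v) = 0"
    using orth_proj_ex1[OF S, of u] by blast
  define d where "d = u - v"
  \<comment> \<open>This is J d, for which omega (J d) w = - cinner d w.\<close>
  define x where "x = (- snd d, fst d)"
  have minus: "cinner (- a) b = - cinner a b" for a b :: 'a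
    using cinner_add_left[of a "- a" b] by (simp add: eq_neg_iff_add_eq_0 add.commute)
  have x: "omega x w = 0" if "w \<in> ?S" for w
  proof -
    have "omega x w = - cinner d w"
      by (simp add: omega_def x_def cinner_prod_def minus)
    also have "cinner d w = cnj (cinner w d)" by (rule cinner_commute)
    also have "\<dots> = 0" using v(2)[OF that] by (simp add: d_def)
    finally show ?thesis by simp
  qed
  have 0: "0 \<in> L" "0 \<in> M" using LM by auto
  have "w \<in> ?S" if "w \<in> L" for w
    using that 0 by (intro CollectI exI[of _ w] exI[of _ 0]) simp
  then have "x \<in> L" using x by (intro Lagrangian_memI[OF L]) blast
  moreover have "w \<in> ?S" if "w \<in> M" for w
    using that 0 by (intro CollectI exI[of _ 0] exI[of _ w]) simp
  then have "x \<in> M" using x by (intro Lagrangian_memI[OF M]) blast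
  ultimately have "x = 0" using LM by blast
  then have "d = 0" by (simp add: x_def prod_eq_iff)
  then have "u \<in> ?S" using v by (simp add: d_def)
  then show ?thesis using that by blast
qed

text \<open>For u in \<alpha> this is u + \<open>graph_map \<alpha> M L u\<close>. It does not
  mention \<alpha>, so one globally linear map serves the forms on all planes.\<close>

definition oblique_proj :: "'a::fd_complex_hilbert set \<Rightarrow> 'a set \<Rightarrow> 'a \<Rightarrow> 'a" where
  "oblique_proj L M u = (THE v. v \<in> L \<and> v - u \<in> M)"

definition transversal :: "('k::fd_complex_hilbert \<times> 'k) set \<Rightarrow> ('k \<times> 'k) set \<Rightarrow> bool" where
  "transversal L M \<longleftrightarrow> Lagrangian L \<and> Lagrangian M \<and> L \<inter> M = {0}"

lemma transversalD:
  assumes "transversal L M"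
  shows "Lagrangian L" "Lagrangian M" "csubspace L" "csubspace M" "L \<inter> M = {0}"
  using assms by (auto simp: transversal_def Lagrangian_csubspace)

lemma oblique_proj_eqI:
  assumes "transversal L M" "v \<in> L" "v - u \<in> M"
  shows "oblique_proj L M u = v"
  unfolding oblique_proj_def
proof (rule the_equality)
  fix w assume w: "w \<in> L \<and> w - u \<in> M"
  note T = transversalD[OF assms(1)]
  have "w - v \<in> L" using w assms T(3) by (simp add: complex_vector.subspace_diff)
  moreover have "(w - u) - (v - u) \<in> M"
    using w assms T(4) complex_vector.subspace_diff by blast
  ultimately have "w - v \<in> L \<inter> M" by simp
  then show "w = v" using T(5) by simp
qed (use assms in simp)

lemma oblique_proj:
  assumes "transversal L M"
  shows "oblique_proj L M u \<in> L" "oblique_proj L M u - u \<in> M"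
proof -
  note T = transversalD[OF assms(1)]
  obtain l m where u: "l \<in> L" "m \<in> M" "u = l + m"
    by (rule Lagrangian_decompose[OF T(1,2,5), of u]) blast
  have "l - u = - m" using u by simp
  then have "l - u \<in> M" using u complex_vector.subspace_neg[OF T(4)] by simp
  then have "oblique_proj L M u = l" by (rule oblique_proj_eqI[OF assms u(1)])
  then show "oblique_proj L M u \<in> L" "oblique_proj L M u - u \<in> M"
    using u \<open>l - u \<in> M\<close> by auto
qed

lemma clinear_oblique_proj:
  assumes "transversal L M"
  shows "clinear (oblique_proj L M)"
proof (rule clinearI)
  note T = transversalD[OF assms(1)]
  note P = oblique_proj[OF assms]
  show "oblique_proj L M (x + y) = oblique_proj L M x + oblique_proj L M y" for x y
  proof (rule oblique_proj_eqI[OF assms])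
    have "(oblique_proj L M x - x) + (oblique_proj L M y - y) \<in> M"
      using P complex_vector.subspace_add[OF T(4)] by blast
    then show "oblique_proj L M x + oblique_proj L M y - (x + y) \<in> M"
      by (simp add: algebra_simps)
  qed (use P complex_vector.subspace_add[OF T(3)] in blast)
  show "oblique_proj L M (c *\<^sub>C x) = c *\<^sub>C oblique_proj L M x" for c x
  proof (rule oblique_proj_eqI[OF assms])
    show "c *\<^sub>C oblique_proj L M x - c *\<^sub>C x \<in> M"
      using complex_vector.subspace_scale[OF T(4) P(2), of c x]
      by (simp add: complex_vector.scale_right_diff_distrib)
  qed (use P complex_vector.subspace_scale[OF T(3)] in blast)
qed

lemma oblique_proj_ident: "transversal L M \<Longrightarrow> u \<in> L \<Longrightarrow> oblique_proj L M u = u"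
  by (rule oblique_proj_eqI) (auto dest: transversalD(4) complex_vector.subspace_0)

text \<open>A projection along M changes a vector only by an element of M, which the outer
  projection ignores. Hence all planes transversal to M are identified with each other through the
  quotient by M.\<close>

lemma oblique_proj_comp:
  assumes "transversal L M" "transversal L' M"
  shows "oblique_proj L M (oblique_proj L' M u) = oblique_proj L M u"
proof (rule oblique_proj_eqI[OF assms(1)])
  note P = oblique_proj[OF assms(1), of u] oblique_proj[OF assms(2), of u]
  show "oblique_proj L M u \<in> L" by (rule P)
  have "(oblique_proj L M u - u) - (oblique_proj L' M u - u) \<in> M"
    using P transversalD(4)[OF assms(1)] complex_vector.subspace_diff by blast
  then show "oblique_proj L M u - oblique_proj L' M u \<in> M" by simp
qed

lemma oblique_proj_bij:
  assumes "transversal L M" "transversal L' M"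
  shows "oblique_proj L M ` L' = L" "inj_on (oblique_proj L M) L'"
proof -
  have inv: "oblique_proj L' M (oblique_proj L M u) = u" if "u \<in> L'" for u
    using that assms by (simp add: oblique_proj_comp oblique_proj_ident)
  then show "inj_on (oblique_proj L M) L'" by (metis inj_onI)
  have "u = oblique_proj L M (oblique_proj L' M u)" if "u \<in> L" for u
    using that assms by (simp add: oblique_proj_comp oblique_proj_ident)
  then show "oblique_proj L M ` L' = L"
    using oblique_proj(1)[OF assms(1)] oblique_proj(1)[OF assms(2)] by blast
qed

text \<open>The graph map and the projection differ by v, which pairs to 0 with u because \<alpha>
  is isotropic.\<close>

lemma Qform_eq_omega:
  assumes "Lagrangian \<alpha>" "transversal \<gamma> M" "u \<in> \<alpha>" "v \<in> \<alpha>"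
  shows "Qform \<alpha> M \<gamma> u v = omega u (oblique_proj \<gamma> M v)"
proof -
  have "graph_map \<alpha> M \<gamma> v = oblique_proj \<gamma> M v - v"
    unfolding graph_map_def
  proof (rule the_equality)
    fix w assume w: "w \<in> M \<and> v + w \<in> \<gamma>"
    then have "oblique_proj \<gamma> M v = v + w" by (intro oblique_proj_eqI assms) auto
    then show "w = oblique_proj \<gamma> M v - v" by simp
  qed (use oblique_proj[OF assms(2)] in simp)
  then show ?thesis
    using Lagrangian_omega[OF assms(1,3,4)] by (simp add: Qform_def omega_diff_right)
qed

text \<open>The difference of the two projections of v lies in M, and so does the difference of u
  and its projection; M is isotropic. For u and v in a plane \<alpha> this reads Q(L, M; L') =
  Q(\<alpha>, M; L') - Q(\<alpha>, M; L), transported to \<alpha>. Symmetry, the sign change on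
  swapping planes and the Kashiwara computation all rest on it.\<close>

lemma omega_oblique_proj:
  assumes "transversal L M" "transversal L' M"
  shows "omega (oblique_proj L M u) (oblique_proj L' M v) =
    omega u (oblique_proj L' M v) - omega u (oblique_proj L M v)"
proof -
  note P = oblique_proj[OF assms(1)] oblique_proj[OF assms(2)]
  let ?d = "oblique_proj L' M v - oblique_proj L M v"
  have "(oblique_proj L' M v - v) - (oblique_proj L M v - v) \<in> M"
    using P transversalD(4)[OF assms(1)] complex_vector.subspace_diff by blast
  then have d: "?d \<in> M" by simp
  have "omega (oblique_proj L M u) (oblique_proj L' M v) = omega (oblique_proj L M u) ?d"
    using Lagrangian_omega[OF transversalD(1)[OF assms(1)] P(1) P(1)] by (simp add: omega_diff_right)
  also have "\<dots> = omega (u + (oblique_proj L M u - u)) ?d" by simp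
  also have "\<dots> = omega u ?d"
    unfolding omega_add_left
    using Lagrangian_omega[OF transversalD(2)[OF assms(1)] P(2) d] by simp
  finally show ?thesis by (simp add: omega_diff_right)
qed

lemma hermitian_form_Qform:
  assumes \<alpha>: "transversal \<alpha> M" and \<gamma>: "transversal \<gamma> M"
  shows "hermitian_form \<alpha> (Qform \<alpha> M \<gamma>)"
proof
  note eq = Qform_eq_omega[OF transversalD(1)[OF \<alpha>] \<gamma>]
  note lin = clinear_oblique_proj[OF \<gamma>]
  note sub = transversalD(3)[OF \<alpha>]
  show "csubspace \<alpha>" by (rule sub)
  show "Qform \<alpha> M \<gamma> u (v + w) = Qform \<alpha> M \<gamma> u v + Qform \<alpha> M \<gamma> u w"
    if "u \<in> \<alpha>" "v \<in> \<alpha>" "w \<in> \<alpha>" for u v w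
    using that complex_vector.subspace_add[OF sub]
    by (simp add: eq clinear_add[OF lin] omega_add_right)
  show "Qform \<alpha> M \<gamma> u (c *\<^sub>C v) = c * Qform \<alpha> M \<gamma> u v" if "u \<in> \<alpha>" "v \<in> \<alpha>" for u v c
    using that complex_vector.subspace_scale[OF sub]
    by (simp add: eq clinear_scale[OF lin] omega_scale_right)
  show "Qform \<alpha> M \<gamma> u v = cnj (Qform \<alpha> M \<gamma> v u)" if "u \<in> \<alpha>" "v \<in> \<alpha>" for u v
  proof -
    let ?g = "oblique_proj \<gamma> M"
    \<comment> \<open>The difference formula with \<alpha> as second plane, where projecting v onto
      \<alpha> does nothing.\<close>
    have "omega (?g u) v = - omega u (?g v)"
      using omega_oblique_proj[OF \<gamma> \<alpha>, of u v] that Lagrangian_omega[OF transversalD(1)[OF \<alpha>]]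
      by (simp add: oblique_proj_ident[OF \<alpha>])
    then show ?thesis using omega_commute[of "?g u" v] that by (simp add: eq)
  qed
qed

text \<open>If v is in the kernel, its projection to \<gamma> is symplectically orthogonal to
  \<alpha> and hence in \<alpha>. It differs from v by an element of \<alpha> \<inter> M =
  0.\<close>

lemma kernel_Qform:
  assumes \<alpha>: "transversal \<alpha> M" and \<gamma>: "transversal \<gamma> M"
  shows "hermitian_form.kernel \<alpha> (Qform \<alpha> M \<gamma>) = \<alpha> \<inter> \<gamma>"
proof -
  interpret hermitian_form \<alpha> "Qform \<alpha> M \<gamma>" by (rule hermitian_form_Qform[OF assms])
  note eq = Qform_eq_omega[OF transversalD(1)[OF \<alpha>] \<gamma>]
  have "v \<in> \<gamma>" if v: "v \<in> \<alpha>" and "\<forall>u\<in>\<alpha>. Qform \<alpha> M \<gamma> u v = 0" for v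
  proof -
    have "oblique_proj \<gamma> M v \<in> \<alpha>"
      using that by (intro Lagrangian_memI'[OF transversalD(1)[OF \<alpha>]]) (auto simp: eq)
    then have "oblique_proj \<gamma> M v - v \<in> \<alpha> \<inter> M"
      using oblique_proj(2)[OF \<gamma>] complex_vector.subspace_diff[OF subspace] v by blast
    then show ?thesis using transversalD(5)[OF \<alpha>] oblique_proj(1)[OF \<gamma>, of v] by simp
  qed
  moreover have "Qform \<alpha> M \<gamma> u v = 0" if "u \<in> \<alpha>" "v \<in> \<alpha>" "v \<in> \<gamma>" for u v
    using that Lagrangian_omega[OF transversalD(1)[OF \<alpha>]] by (simp add: eq oblique_proj_ident[OF \<gamma>])
  ultimately show ?thesis by (auto simp: kernel_def)
qed

text \<open>Projecting \<alpha> to \<gamma> along M carries -Q(\<alpha>, M; \<gamma>) to Q(\<gamma>,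
  M; \<alpha>), by the difference formula with \<alpha> as second plane.\<close>

lemma neg_index_Qform_swap:
  assumes \<alpha>: "transversal \<alpha> M" and \<gamma>: "transversal \<gamma> M"
  shows "neg_index \<gamma> (Qform \<gamma> M \<alpha>) = neg_index \<alpha> (\<lambda>u v. - Qform \<alpha> M \<gamma> u v)"
proof -
  have "neg_index (oblique_proj \<gamma> M ` \<alpha>) (Qform \<gamma> M \<alpha>) = neg_index \<alpha> (\<lambda>u v. - Qform \<alpha> M \<gamma> u v)"
  proof (rule neg_index_image)
    fix u assume u: "u \<in> \<alpha>"
    have "Qform \<gamma> M \<alpha> (oblique_proj \<gamma> M u) (oblique_proj \<gamma> M u) =
        omega (oblique_proj \<gamma> M u) (oblique_proj \<alpha> M u)"
      using oblique_proj(1)[OF \<gamma>] transversalD(1)[OF \<gamma>]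
      by (simp add: Qform_eq_omega \<alpha> oblique_proj_comp[OF \<alpha> \<gamma>])
    also have "\<dots> = - omega u (oblique_proj \<gamma> M u)"
      unfolding omega_oblique_proj[OF \<gamma> \<alpha>]
      using Lagrangian_omega[OF transversalD(1)[OF \<alpha>] u u] by (simp add: oblique_proj_ident[OF \<alpha> u])
    finally show "Re (Qform \<gamma> M \<alpha> (oblique_proj \<gamma> M u) (oblique_proj \<gamma> M u)) = Re (- Qform \<alpha> M \<gamma> u u)"
      using u by (simp add: Qform_eq_omega[OF transversalD(1)[OF \<alpha>] \<gamma>])
  qed (use assms in \<open>auto intro: clinear_oblique_proj oblique_proj_bij transversalD\<close>)
  then show ?thesis by (simp add: oblique_proj_bij[OF \<gamma> \<alpha>])
qed

text \<open>The two indices are the negative and the positive index of the same form, whose kernel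
  is \<alpha> \<inter> \<gamma>.\<close>

lemma neg_index_Qform_sum:
  assumes \<alpha>: "transversal \<alpha> M" and \<gamma>: "transversal \<gamma> M"
  shows "neg_index \<alpha> (Qform \<alpha> M \<gamma>) + neg_index \<gamma> (Qform \<gamma> M \<alpha>) + cdim (\<alpha> \<inter> \<gamma>) = cdim \<alpha>"
  using hermitian_form.inertia(1)[OF hermitian_form_Qform[OF assms]]
  by (simp add: kernel_Qform[OF assms] neg_index_Qform_swap[OF assms])

section \<open>The Kashiwara form in a chart\<close>

lemma hermitian_form_diff:
  assumes "hermitian_form V q" "hermitian_form V r"
  shows "hermitian_form V (\<lambda>u v. q u v - r u v)"
proof -
  interpret q: hermitian_form V q by fact
  interpret r: hermitian_form V r by fact
  show ?thesis
    by unfold_locales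
      (auto simp: q.subspace q.add_right r.add_right q.scale_right r.scale_right algebra_simps
        q.herm[symmetric] r.herm[symmetric])
qed

lemma hermitian_form_Times:
  assumes "hermitian_form (A :: 'a::fd_complex_hilbert set) q"
    and "hermitian_form (B :: 'b::fd_complex_hilbert set) r"
  shows "hermitian_form (A \<times> B) (\<lambda>u v. q (fst u) (fst v) + r (snd u) (snd v))"
proof -
  interpret q: hermitian_form A q by fact
  interpret r: hermitian_form B r by fact
  show ?thesis
    by unfold_locales
      (auto simp: q.subspace r.subspace cdim_Times scaleC_prod_def q.add_right r.add_right
        q.scale_right r.scale_right algebra_simps q.herm[symmetric] r.herm[symmetric])
qed

text \<open>Not Hermitian: only the real parts of its diagonal values are used.\<close>

definition kashiwara_form ::
    "('k \<times> 'k) \<times> ('k \<times> 'k) \<times> ('k::fd_complex_hilbert \<times> 'k) \<Rightarrow> ('k \<times> 'k) \<times> ('k \<times> 'k) \<times> ('k \<times> 'k) \<Rightarrow> complex"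
  where "kashiwara_form u v = omega (fst u) (fst (snd v)) + omega (fst (snd u)) (snd (snd v))
    + omega (snd (snd u)) (fst v)"

text \<open>
  In the chart given by \<open>M\<close>, the substitution \<open>(p, q, r) \<mapsto> (p + r, p + q, q + r)\<close> diagonalises the
  Kashiwara form into the three forms \<open>Q(L1, M; L2)\<close>, \<open>Q(L2, M; L3)\<close> and \<open>- Q(L1, M; L3)\<close>.
\<close>

lemma neg_index_kashiwara_form:
  fixes M :: "('k::fd_complex_hilbert \<times> 'k) set"
  assumes L1: "transversal L1 M" and L2: "transversal L2 M" and L3: "transversal L3 M"
  shows "neg_index (L1 \<times> L2 \<times> L3) kashiwara_form =
    neg_index L1 (Qform L1 M L2) + neg_index L2 (Qform L2 M L3) + neg_index L1 (\<lambda>u v. - Qform L1 M L3 u v)"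
proof -
  let ?g2 = "oblique_proj L2 M" and ?g3 = "oblique_proj L3 M" and ?g1 = "oblique_proj L1 M"
  let ?P = "Qform L1 M L2" and ?S = "Qform L1 M L3"
  \<comment> \<open>Q(L2, M; L3) carried back to \<open>L1\<close>.\<close>
  let ?R = "\<lambda>u v. ?S u v - ?P u v"
  note hP = hermitian_form_Qform[OF L1 L2] and hS = hermitian_form_Qform[OF L1 L3]
  note hR = hermitian_form_diff[OF hS hP]
  note hN = hermitian_form.hermitian_uminus[OF hS]
  interpret P: hermitian_form L1 ?P by (rule hP)
  interpret S: hermitian_form L1 ?S by (rule hS)
  interpret R: hermitian_form L1 ?R by (rule hR)
  have sub: "csubspace L1" by (rule transversalD(3)[OF L1])
  note eqP = Qform_eq_omega[OF transversalD(1)[OF L1] L2]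
  note eqS = Qform_eq_omega[OF transversalD(1)[OF L1] L3]
  have R: "neg_index L2 (Qform L2 M L3) = neg_index L1 ?R"
  proof -
    have "neg_index (?g2 ` L1) (Qform L2 M L3) = neg_index L1 ?R"
    proof (rule neg_index_image)
      fix u assume u: "u \<in> L1"
      have "Qform L2 M L3 (?g2 u) (?g2 u) = omega (?g2 u) (?g3 u)"
        using oblique_proj(1)[OF L2] transversalD(1)[OF L2]
        by (simp add: Qform_eq_omega L3 oblique_proj_comp[OF L3 L2])
      then show "Re (Qform L2 M L3 (?g2 u) (?g2 u)) = Re (?R u u)"
        using u by (simp add: eqP eqS omega_oblique_proj[OF L2 L3])
    qed (use L1 L2 in \<open>auto intro: clinear_oblique_proj oblique_proj_bij transversalD\<close>)
    then show ?thesis by (simp add: oblique_proj_bij[OF L2 L1])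
  qed
  let ?H = "\<lambda>u v. ?P (fst u) (fst v) + (?R (fst (snd u)) (fst (snd v)) + - ?S (snd (snd u)) (snd (snd v)))"
  have H: "neg_index (L1 \<times> L1 \<times> L1) ?H = neg_index L1 ?P + (neg_index L1 ?R + neg_index L1 (\<lambda>u v. - ?S u v))"
    using neg_index_Times[OF hP hermitian_form_Times[OF hR hN]] neg_index_Times[OF hR hN] by simp
  define \<Theta> where "\<Theta> w = (fst w + snd (snd w), ?g2 (fst w + fst (snd w)), ?g3 (fst (snd w) + snd (snd w)))"
    for w :: "('k \<times> 'k) \<times> ('k \<times> 'k) \<times> ('k \<times> 'k)"
  note lin2 = clinear_oblique_proj[OF L2] and lin3 = clinear_oblique_proj[OF L3]
  have lin: "clinear \<Theta>"
    by (rule clinearI)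
      (simp_all add: \<Theta>_def scaleC_prod_def[where 'b = "('k \<times> 'k) \<times> ('k \<times> 'k)"]
        scaleC_prod_def[where 'b = "'k \<times> 'k"] clinear_add[OF lin2] clinear_add[OF lin3]
        clinear_scale[OF lin2] clinear_scale[OF lin3] scaleC_add_right add_ac)
  define h where "h x = (1/2) *\<^sub>R x" for x :: "'k \<times> 'k"
  have hh: "h x + h x = x" for x
    by (simp add: h_def scaleR_add_left[symmetric])
  have h_add: "h (x + y) = h x + h y" "h (x - y) = h x - h y" for x y
    by (simp_all add: h_def scaleR_add_right scaleR_diff_right)
  have hL: "h x \<in> L1" if "x \<in> L1" for x
    using that complex_vector.subspace_scale[OF sub] by (simp add: h_def scaleR_scaleC)
  \<comment> \<open>Solves a = p + r, b = p + q, c = q + r for p, q, r, after b and c have been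
    projected to \<open>L1\<close>.\<close>
  define \<Psi> where "\<Psi> w = (h (fst w + ?g1 (fst (snd w)) - ?g1 (snd (snd w))),
      h (?g1 (fst (snd w)) + ?g1 (snd (snd w)) - fst w), h (?g1 (snd (snd w)) + fst w - ?g1 (fst (snd w))))"
    for w :: "('k \<times> 'k) \<times> ('k \<times> 'k) \<times> ('k \<times> 'k)"
  have add: "x + y \<in> L1" if "x \<in> L1" "y \<in> L1" for x y
    using that complex_vector.subspace_add[OF sub] by blast
  have diff: "x - y \<in> L1" if "x \<in> L1" "y \<in> L1" for x y
    using that complex_vector.subspace_diff[OF sub] by blast
  have \<Psi>\<Theta>: "\<Psi> (\<Theta> w) = w" if w: "w \<in> L1 \<times> L1 \<times> L1" for w
  proof -
    obtain p q r where pqr: "w = (p, q, r)" "p \<in> L1" "q \<in> L1" "r \<in> L1" using w by auto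
    have "?g1 (?g2 (p + q)) = p + q" "?g1 (?g3 (q + r)) = q + r"
      using pqr by (auto simp: oblique_proj_comp[OF L1] L2 L3 oblique_proj_ident[OF L1] add)
    then show ?thesis
      using hh[of p] hh[of q] hh[of r] by (simp add: pqr(1) \<Theta>_def \<Psi>_def h_add)
  qed
  have \<Theta>\<Psi>: "\<Theta> (\<Psi> w) = w" "\<Psi> w \<in> L1 \<times> L1 \<times> L1" if w: "w \<in> L1 \<times> L2 \<times> L3" for w
  proof -
    obtain a b c where abc: "w = (a, b, c)" "a \<in> L1" "b \<in> L2" "c \<in> L3" using w by auto
    have g: "?g1 b \<in> L1" "?g1 c \<in> L1" "?g2 (?g1 b) = b" "?g3 (?g1 c) = c"
      using abc by (auto simp: oblique_proj[OF L1] oblique_proj_comp[OF L2 L1]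
          oblique_proj_comp[OF L3 L1] oblique_proj_ident[OF L2] oblique_proj_ident[OF L3])
    then show "\<Psi> w \<in> L1 \<times> L1 \<times> L1"
      using abc by (auto simp: \<Psi>_def intro!: hL add diff)
    have "h (a + ?g1 b - ?g1 c) + h (?g1 b + ?g1 c - a) = ?g1 b"
      "h (?g1 b + ?g1 c - a) + h (?g1 c + a - ?g1 b) = ?g1 c"
      "h (a + ?g1 b - ?g1 c) + h (?g1 c + a - ?g1 b) = a"
      unfolding h_add[symmetric] using hh by (simp_all add: h_add)
    then show "\<Theta> (\<Psi> w) = w"
      using g by (simp add: abc(1) \<Theta>_def \<Psi>_def)
  qed
  have \<Theta>_mem: "\<Theta> w \<in> L1 \<times> L2 \<times> L3" if "w \<in> L1 \<times> L1 \<times> L1" for w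
    using that add by (simp add: \<Theta>_def oblique_proj(1)[OF L2] oblique_proj(1)[OF L3] mem_Times_iff)
  have "neg_index (\<Theta> ` (L1 \<times> L1 \<times> L1)) kashiwara_form = neg_index (L1 \<times> L1 \<times> L1) ?H"
  proof (rule neg_index_image[OF lin])
    show "inj_on \<Theta> (L1 \<times> L1 \<times> L1)" using \<Psi>\<Theta> by (metis inj_onI)
    show "csubspace (L1 \<times> L1 \<times> L1)" by (intro cdim_Times sub)
    fix w assume "w \<in> L1 \<times> L1 \<times> L1"
    then obtain p q r where w: "w = (p, q, r)" "p \<in> L1" "q \<in> L1" "r \<in> L1" by auto
    \<comment> \<open>With P and S for \<open>?P\<close> and \<open>?S\<close>, the real part is
      that of P(p + r, p + q) + (S - P)(p + q, q + r) - S(p + r, q + r). By Hermitian symmetry all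
      mixed terms cancel.\<close>
    have "omega (?g2 (p + q)) (?g3 (q + r)) = ?R (p + q) (q + r)"
      using w by (simp add: omega_oblique_proj[OF L2 L3] eqP eqS add)
    moreover have "Re (omega (?g3 (q + r)) (p + r)) = - Re (?S (p + r) (q + r))"
      using w omega_commute[of "?g3 (q + r)" "p + r"] by (simp add: eqS add)
    moreover have "omega (p + r) (?g2 (p + q)) = ?P (p + r) (p + q)"
      using w by (simp add: eqP add)
    moreover have "Re (?P x y) = Re (?P y x)" "Re (?S x y) = Re (?S y x)" if "x \<in> L1" "y \<in> L1" for x y
      using P.herm[OF that] S.herm[OF that] by simp_all
    ultimately show "Re (kashiwara_form (\<Theta> w) (\<Theta> w)) = Re (?H w w)"
      using w by (simp add: kashiwara_form_def \<Theta>_def P.add_left P.add_right S.add_left S.add_right add)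
  qed
  moreover have "\<Theta> ` (L1 \<times> L1 \<times> L1) = L1 \<times> L2 \<times> L3"
  proof (intro equalityI subsetI)
    fix w assume "w \<in> L1 \<times> L2 \<times> L3"
    then show "w \<in> \<Theta> ` (L1 \<times> L1 \<times> L1)" using \<Theta>\<Psi> by (metis imageI)
  qed (use \<Theta>_mem in blast)
  ultimately show ?thesis using H R by simp
qed

text \<open>Graphs of self-adjoint operators are Lagrangian; real multiples of the identity form a
  one-parameter family from which the auxiliary plane is taken.\<close>

lemma Lagrangian_scaled_diagonal:
  "Lagrangian (range (\<lambda>x::'k::fd_complex_hilbert. (x, complex_of_real s *\<^sub>C x)))" (is "Lagrangian ?M")
  unfolding Lagrangian_def
proof
  have "clinear (\<lambda>x::'k. (x, complex_of_real s *\<^sub>C x))"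
    by (rule clinearI) (simp_all add: scaleC_prod_def scaleC_add_right scaleC_scaleC mult.commute)
  then show "csubspace ?M" by (rule csubspace_image) (rule complex_vector.subspace_UNIV)
  have omega: "omega u (x, complex_of_real s *\<^sub>C x) = cinner (complex_of_real s *\<^sub>C fst u - snd u) x" for u x
    using cinner_add_left[of "complex_of_real s *\<^sub>C fst u - snd u" "snd u" x]
    by (simp add: omega_def cinner_scaleC_left cinner_scaleC_right)
  show "?M = {u. \<forall>v\<in>?M. omega u v = 0}"
  proof (intro equalityI subsetI CollectI ballI)
    fix u v assume "u \<in> ?M" "v \<in> ?M"
    then obtain x y where uv: "u = (x, complex_of_real s *\<^sub>C x)" "v = (y, complex_of_real s *\<^sub>C y)"
      by blast
    show "omega u v = 0" unfolding uv omega by simp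
  next
    fix u assume "u \<in> {u. \<forall>v\<in>?M. omega u v = 0}"
    then have "omega u (x, complex_of_real s *\<^sub>C x) = 0" for x by blast
    then have "cinner (complex_of_real s *\<^sub>C fst u - snd u) (complex_of_real s *\<^sub>C fst u - snd u) = 0"
      unfolding omega .
    then have "u = (fst u, complex_of_real s *\<^sub>C fst u)"
      by (simp add: cinner_self_eq_0_iff prod_eq_iff)
    then show "u \<in> ?M" by blast
  qed
qed

lemma orthogonal_cindependent:
  fixes P :: "'a::fd_complex_hilbert set"
  assumes "0 \<notin> P" "\<And>x y. x \<in> P \<Longrightarrow> y \<in> P \<Longrightarrow> x \<noteq> y \<Longrightarrow> cinner x y = 0"
  shows "\<not> cdependent P"
proof
  assume "cdependent P"
  then obtain a where a: "a \<in> P" "a \<in> cspan (P - {a})"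
    unfolding complex_vector.dependent_def by blast
  have "csubspace {y. cinner a y = 0}"
    by (auto simp: complex_vector.subspace_def cinner_add_right cinner_scaleC_right)
  moreover have "P - {a} \<subseteq> {y. cinner a y = 0}" using assms(2)[OF a(1)] by blast
  ultimately have "cspan (P - {a}) \<subseteq> {y. cinner a y = 0}"
    by (rule complex_vector.span_minimal[rotated])
  then have "a = 0" using a cinner_self_eq_0_iff[of a] by blast
  then show False using a assms by blast
qed

text \<open>
  If \<open>(x, s x)\<close> and \<open>(y, r y)\<close> both lie in the Lagrangian plane \<open>L\<close>, then \<open>(r - s) \<langle>x, y\<rangle> = 0\<close>.
\<close>

lemma finite_non_transversal:
  fixes L :: "('k::fd_complex_hilbert \<times> 'k) set"
  assumes L: "Lagrangian L"
  shows "finite {s. L \<inter> range (\<lambda>x. (x, complex_of_real s *\<^sub>C x)) \<noteq> {0}}" (is "finite ?B")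
proof -
  have "\<exists>x. x \<noteq> 0 \<and> (x, complex_of_real s *\<^sub>C x) \<in> L" if "s \<in> ?B" for s
  proof -
    have "0 \<in> L" using Lagrangian_csubspace[OF L] complex_vector.subspace_0 by blast
    moreover have "0 \<in> range (\<lambda>x::'k. (x, complex_of_real s *\<^sub>C x))"
      by (auto simp: zero_prod_def intro!: image_eqI[of _ _ 0])
    ultimately have "\<exists>z \<in> L \<inter> range (\<lambda>x. (x, complex_of_real s *\<^sub>C x)). z \<noteq> 0"
      using that by auto
    then obtain x where "(x, complex_of_real s *\<^sub>C x) \<in> L" "(x, complex_of_real s *\<^sub>C x) \<noteq> 0"
      by blast
    then show ?thesis by (intro exI[of _ x]) (auto simp: zero_prod_def)
  qed
  then have "\<forall>s\<in>?B. \<exists>x. x \<noteq> 0 \<and> (x, complex_of_real s *\<^sub>C x) \<in> L" by (rule ballI)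
  from bchoice[OF this] obtain f where f: "\<forall>s\<in>?B. f s \<noteq> 0 \<and> (f s, complex_of_real s *\<^sub>C f s) \<in> L"
    by (rule exE)
  have orth: "cinner (f s) (f r) = 0" if "s \<in> ?B" "r \<in> ?B" "s \<noteq> r" for s r
  proof -
    have "omega (f s, complex_of_real s *\<^sub>C f s) (f r, complex_of_real r *\<^sub>C f r) = 0"
      using bspec[OF f that(1)] bspec[OF f that(2)] by (intro Lagrangian_omega[OF L]) auto
    then show ?thesis using that by (simp add: omega_def cinner_scaleC_left cinner_scaleC_right)
  qed
  have inj: "inj_on f ?B"
  proof (rule inj_onI, rule ccontr)
    fix s r assume sr: "s \<in> ?B" "r \<in> ?B" "f s = f r" "s \<noteq> r"
    have "cinner (f s) (f s) = 0" using orth[OF sr(1,2,4)] sr(3) by simp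
    then show False using bspec[OF f sr(1)] by (simp add: cinner_self_eq_0_iff)
  qed
  have "\<not> cdependent (f ` ?B)"
  proof (rule orthogonal_cindependent)
    show "0 \<notin> f ` ?B" using f by (metis (no_types, lifting) imageE)
    fix x y assume "x \<in> f ` ?B" "y \<in> f ` ?B" "x \<noteq> y"
    then obtain s r where sr: "s \<in> ?B" "r \<in> ?B" "x = f s" "y = f r" by blast
    then have "s \<noteq> r" using \<open>x \<noteq> y\<close> by metis
    then show "cinner x y = 0" unfolding sr(3,4) by (rule orth[OF sr(1,2)])
  qed
  then have "finite (f ` ?B)" by (rule finite_cindependent)
  then show ?thesis using inj finite_imageD by blast
qed

text \<open>Each plane rules out only finitely many slopes s, and there are infinitely many
  reals.\<close>

lemma common_transversal:
  fixes \<L> :: "('k::fd_complex_hilbert \<times> 'k) set set"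
  assumes "finite \<L>" "\<And>L. L \<in> \<L> \<Longrightarrow> Lagrangian L"
  obtains M where "\<And>L. L \<in> \<L> \<Longrightarrow> transversal L M"
proof -
  define M where "M s = range (\<lambda>x::'k. (x, complex_of_real s *\<^sub>C x))" for s
  have "finite (\<Union>L\<in>\<L>. {s. L \<inter> M s \<noteq> {0}})"
    unfolding M_def using assms finite_non_transversal by blast
  then obtain s where "s \<notin> (\<Union>L\<in>\<L>. {s. L \<inter> M s \<noteq> {0}})"
    using ex_new_if_finite[OF infinite_UNIV_char_0] by blast
  then have "transversal L (M s)" if "L \<in> \<L>" for L
    using that assms(2) Lagrangian_scaled_diagonal unfolding transversal_def M_def by blast
  then show ?thesis using that by blast
qed

lemma duistermaat_index_eq:
  assumes L1: "transversal L1 M" and L2: "transversal L2 M" and L3: "transversal L3 M"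
  shows "duistermaat_index L1 L2 L3 = int (neg_index L2 (Qform L2 M L3))
    - int (neg_index L1 (Qform L1 M L3)) + int (neg_index L1 (Qform L1 M L2))"
proof -
  \<comment> \<open>By the swap and sum lemmas, the index of -Q(L1, N; L3) is dim L1 - dim(L1
    \<inter> L3) minus the index of Q(L1, N; L3); this trades the last summand of the Kashiwara
    index.\<close>
  have eq: "int (neg_index L2 (Qform L2 N L3)) - int (neg_index L1 (Qform L1 N L3))
      + int (neg_index L1 (Qform L1 N L2)) =
      int (neg_index (L1 \<times> L2 \<times> L3) kashiwara_form) - int (cdim L1) + int (cdim (L1 \<inter> L3))"
    if "transversal L1 N" "transversal L2 N" "transversal L3 N" for N
    using neg_index_kashiwara_form[OF that] neg_index_Qform_sum[OF that(1,3)]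
      neg_index_Qform_swap[OF that(1,3)] by simp
  define N where "N = (SOME M. Lagrangian M \<and> L1 \<inter> M = {0} \<and> L2 \<inter> M = {0} \<and> L3 \<inter> M = {0})"
  have "Lagrangian N \<and> L1 \<inter> N = {0} \<and> L2 \<inter> N = {0} \<and> L3 \<inter> N = {0}"
    unfolding N_def by (rule someI[of _ M]) (use assms in \<open>auto simp: transversal_def\<close>)
  then have "transversal L1 N" "transversal L2 N" "transversal L3 N"
    using assms by (auto simp: transversal_def)
  then show ?thesis
    unfolding duistermaat_index_def N_def[symmetric] Let_def
    using eq[of N] eq[OF assms] by simp
qed


section \<open>Dependence of oblique projections on the plane\<close>

lemma scaleC_eq_scaleR: "c *\<^sub>C x = Re c *\<^sub>R x + Im c *\<^sub>R (\<i> *\<^sub>C x)"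
proof -
  have "c *\<^sub>C x = (complex_of_real (Re c) + complex_of_real (Im c) * \<i>) *\<^sub>C x"
    by (simp add: complex_eq_iff)
  then show ?thesis by (simp only: scaleC_add_left scaleR_scaleC scaleC_scaleC)
qed

lemma norm_sq_cinner: "(norm x)\<^sup>2 = Re (cinner x x)"
  by (simp add: power2_norm_eq_inner inner_eq_Re_cinner)

lemma norm_scaleC: "norm (c *\<^sub>C x) = cmod c * norm x"
proof -
  have "cinner (c *\<^sub>C x) (c *\<^sub>C x) = (c * cnj c) * cinner x x"
    by (simp add: cinner_scaleC_left cinner_scaleC_right)
  also have "c * cnj c = complex_of_real ((cmod c)\<^sup>2)" by (rule complex_norm_square[symmetric])
  finally have "(norm (c *\<^sub>C x))\<^sup>2 = (cmod c * norm x)\<^sup>2"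
    unfolding norm_sq_cinner power_mult_distrib
    by (simp only: times_complex.sel Re_complex_of_real Im_complex_of_real)
  then show ?thesis by (simp add: power2_eq_iff_nonneg)
qed

text \<open>Compactness has to come from the finite spanning set. Splitting off the part d of b
  orthogonal to the span of B presents the ball as a closed part of the image of a
  smaller-dimensional ball times a complex disc.\<close>

lemma compact_cspan_cball:
  assumes "finite (B :: 'a::fd_complex_hilbert set)"
  shows "compact {x \<in> cspan B. norm x \<le> r}"
  using assms
proof (induction B arbitrary: r)
  case empty
  have "{x \<in> cspan {}. norm x \<le> r} = (if 0 \<le> r then {0} else {} :: 'a set)" by auto
  then show ?case by simp
next
  case (insert b B)
  obtain p where p: "p \<in> cspan B" "\<And>w. w \<in> cspan B \<Longrightarrow> cinner w (b - p) = 0"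
    using orth_proj_ex_cspan[OF insert.hyps(1), of b] by blast
  define d where "d = b - p"
  show ?case
  proof (cases "d = 0")
    case True
    then have "b \<in> cspan B" using p by (simp add: d_def)
    then show ?thesis using insert.IH by (simp add: complex_vector.span_redundant)
  next
    case False
    let ?K = "{x \<in> cspan B. norm x \<le> r} \<times> cball (0 :: complex) (r / norm d)"
    let ?f = "\<lambda>(s, c). s + c *\<^sub>C d"
    have "continuous_on ?K (\<lambda>z. fst z + (Re (snd z) *\<^sub>R d + Im (snd z) *\<^sub>R (\<i> *\<^sub>C d)))"
      by (intro continuous_intros)
    then have "continuous_on ?K ?f"
      by (simp add: case_prod_beta scaleC_eq_scaleR[symmetric])
    then have "compact (?f ` ?K)"
      by (intro compact_continuous_image compact_Times insert.IH compact_cball)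
    then have "compact (?f ` ?K \<inter> cball 0 r)" by (intro compact_Int_closed closed_cball)
    moreover have "?f ` ?K \<inter> cball 0 r = {x \<in> cspan (insert b B). norm x \<le> r}"
    proof (intro equalityI subsetI)
      fix x assume "x \<in> ?f ` ?K \<inter> cball 0 r"
      then obtain s c where x: "x = s + c *\<^sub>C d" "s \<in> cspan B" "norm x \<le> r" by auto
      have sub: "cspan B \<subseteq> cspan (insert b B)" by (intro complex_vector.span_mono) auto
      have "d \<in> cspan (insert b B)"
        unfolding d_def using sub p complex_vector.span_base[of b "insert b B"]
        by (intro complex_vector.span_diff) auto
      then have "x \<in> cspan (insert b B)"
        unfolding x using x(2) sub by (intro complex_vector.span_add complex_vector.span_scale) auto
      then show "x \<in> {x \<in> cspan (insert b B). norm x \<le> r}" using x by simp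
    next
      fix x assume "x \<in> {x \<in> cspan (insert b B). norm x \<le> r}"
      then have x: "x \<in> cspan (insert b B)" "norm x \<le> r" by auto
      then obtain c where c: "x - c *\<^sub>C b \<in> cspan B"
        using complex_vector.span_breakdown_eq by blast
      define s where "s = (x - c *\<^sub>C b) + c *\<^sub>C p"
      have s: "s \<in> cspan B"
        unfolding s_def using c p by (intro complex_vector.span_add complex_vector.span_scale)
      have xs: "x = s + c *\<^sub>C d"
        by (simp add: s_def d_def complex_vector.scale_right_diff_distrib)
      \<comment> \<open>Orthogonality gives Pythagoras, which bounds both components of x by its
        norm.\<close>
      have "cinner s (c *\<^sub>C d) = 0" using p(2)[OF s] by (simp add: cinner_scaleC_right d_def)
      then have "inner s (c *\<^sub>C d) = 0" by (simp add: inner_eq_Re_cinner)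
      then have eq: "(norm x)\<^sup>2 = (norm s)\<^sup>2 + (norm (c *\<^sub>C d))\<^sup>2"
        unfolding xs power2_norm_eq_inner by (simp add: inner_add_left inner_add_right inner_commute)
      have "(norm s)\<^sup>2 \<le> (norm x)\<^sup>2" "(norm (c *\<^sub>C d))\<^sup>2 \<le> (norm x)\<^sup>2"
        unfolding eq by auto
      then have "norm s \<le> norm x" "norm (c *\<^sub>C d) \<le> norm x"
        by (auto dest: power2_le_imp_le)
      then have "norm s \<le> r" "cmod c \<le> r / norm d"
        using x(2) False by (auto simp: norm_scaleC pos_le_divide_eq)
      then have "(s, c) \<in> ?K" using s by simp
      then have "x \<in> ?f ` ?K" unfolding xs by (rule rev_image_eqI) simp
      then show "x \<in> ?f ` ?K \<inter> cball 0 r" using x by simp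
    qed
    ultimately show ?thesis by simp
  qed
qed

lemma compact_sphere_Int_csubspace:
  fixes S :: "'a::fd_complex_hilbert set"
  assumes "csubspace S"
  shows "compact (S \<inter> sphere 0 r)"
proof -
  obtain B where "finite B" "cspan B = S" using csubspace_finite_cspan[OF assms] by metis
  moreover have "closed {x::'a. norm x = r}" by (intro closed_Collect_eq continuous_intros)
  ultimately have "compact ({x \<in> S. norm x \<le> r} \<inter> {x. norm x = r})"
    using compact_cspan_cball by (intro compact_Int_closed) auto
  moreover have "{x \<in> S. norm x \<le> r} \<inter> {x. norm x = r} = S \<inter> sphere 0 r" by auto
  ultimately show ?thesis by simp
qed

lemma injective_blinfun_bounded_below:
  fixes T :: "'a::fd_complex_hilbert \<Rightarrow>\<^sub>L 'b::real_normed_vector"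
  assumes inj: "\<And>x. T x = 0 \<Longrightarrow> x = 0"
  obtains \<delta> where "\<delta> > 0" "\<And>x. \<delta> * norm x \<le> norm (T x)"
proof (cases "sphere (0::'a) 1 = {}")
  \<comment> \<open>In the zero space the sphere is empty and there is no minimum to take; every
    constant works.\<close>
  case True
  have "x = 0" for x :: 'a
  proof (rule ccontr)
    assume "x \<noteq> 0"
    then have "sgn x \<in> sphere 0 1" by (simp add: norm_sgn)
    then show False using True by simp
  qed
  then have "1 * norm x \<le> norm (T x)" for x by (metis mult_1 norm_ge_zero norm_zero)
  then show ?thesis using that[of 1] by simp
next
  case False
  have "compact (sphere (0::'a) 1)"
    using compact_sphere_Int_csubspace[OF complex_vector.subspace_UNIV, of 1] by simp
  moreover have "continuous_on (sphere 0 1) (\<lambda>x. norm (T x))" by (intro continuous_intros)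
  ultimately obtain z where z: "z \<in> sphere 0 1" "\<And>x. x \<in> sphere 0 1 \<Longrightarrow> norm (T z) \<le> norm (T x)"
    using continuous_attains_inf[of "sphere 0 1" "\<lambda>x. norm (T x)"] False by blast
  have "norm (T z) * norm x \<le> norm (T x)" for x
  proof (cases "x = 0")
    case False
    then have "norm (T z) \<le> norm (T (sgn x))" by (intro z) (simp add: norm_sgn)
    also have "\<dots> = norm (T x) / norm x"
      by (simp add: sgn_div_norm blinfun.scaleR_right divide_inverse mult.commute)
    finally show ?thesis using False by (simp add: pos_le_divide_eq)
  qed (simp add: blinfun.zero_right)
  moreover have "norm (T z) > 0" using inj z(1) by force
  ultimately show ?thesis using that by blast
qed

text \<open>An error below \<delta> / 2 in operator norm leaves at least half of the lower bound
  \<delta> of the limit.\<close>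

lemma eventually_bounded_below:
  fixes T :: "'i \<Rightarrow> 'a::fd_complex_hilbert \<Rightarrow>\<^sub>L 'b::real_normed_vector" and T0 :: "'a \<Rightarrow>\<^sub>L 'b"
  assumes T: "(T \<longlongrightarrow> T0) F" and inj: "\<And>x. T0 x = 0 \<Longrightarrow> x = 0"
  obtains \<delta> where "\<delta> > 0" "\<forall>\<^sub>F i in F. \<forall>x. \<delta> * norm x \<le> norm (T i x)"
proof -
  obtain \<delta> where \<delta>: "\<delta> > 0" "\<And>x. \<delta> * norm x \<le> norm (T0 x)"
    using injective_blinfun_bounded_below[OF inj] by metis
  have "\<forall>\<^sub>F i in F. dist (T i) T0 < \<delta> / 2"
    using T \<delta>(1) by (intro tendstoD) auto
  then have "\<forall>\<^sub>F i in F. \<forall>x. \<delta> / 2 * norm x \<le> norm (T i x)"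
  proof (rule eventually_mono, intro allI)
    fix i and x :: 'a assume "dist (T i) T0 < \<delta> / 2"
    then have "norm (T0 - T i) * norm x \<le> \<delta> / 2 * norm x"
      by (intro mult_right_mono) (auto simp: dist_norm norm_minus_commute)
    then have "norm ((T0 - T i) x) \<le> \<delta> / 2 * norm x"
      using norm_blinfun[of "T0 - T i" x] by linarith
    moreover have "norm (T0 x) \<le> norm ((T0 - T i) x) + norm (T i x)"
      using norm_triangle_ineq[of "(T0 - T i) x" "T i x"] by (simp add: blinfun.diff_left)
    ultimately show "\<delta> / 2 * norm x \<le> norm (T i x)" using \<delta>(2)[of x] by linarith
  qed
  then show ?thesis using that[of "\<delta> / 2"] \<delta>(1) by simp
qed

text \<open>A uniform lower bound lets convergence pass from the images to the solutions. It is
  applied once to oblique projections and once to their difference quotients.\<close>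

lemma tendsto_of_injective_blinfun:
  fixes T :: "'i \<Rightarrow> 'a::fd_complex_hilbert \<Rightarrow>\<^sub>L 'b::real_normed_vector" and T0 :: "'a \<Rightarrow>\<^sub>L 'b"
  assumes T: "(T \<longlongrightarrow> T0) F" and inj: "\<And>x. T0 x = 0 \<Longrightarrow> x = 0"
    and Tx: "((\<lambda>i. T i (x i)) \<longlongrightarrow> T0 x0) F"
  shows "(x \<longlongrightarrow> x0) F"
proof -
  obtain \<delta> where \<delta>: "\<delta> > 0" "\<forall>\<^sub>F i in F. \<forall>x. \<delta> * norm x \<le> norm (T i x)"
    using eventually_bounded_below[OF T inj] by metis
  have "((\<lambda>i. T i x0) \<longlongrightarrow> T0 x0) F" by (intro tendsto_intros T)
  from tendsto_diff[OF Tx this] have "((\<lambda>i. T i (x i) - T i x0) \<longlongrightarrow> 0) F" by simp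
  then have "((\<lambda>i. T i (x i - x0)) \<longlongrightarrow> 0) F" by (simp add: blinfun.diff_right)
  then have "((\<lambda>i. norm (T i (x i - x0)) / \<delta>) \<longlongrightarrow> 0) F"
    by (intro tendsto_divide_zero tendsto_norm_zero)
  moreover have "\<forall>\<^sub>F i in F. norm (x i - x0) \<le> norm (T i (x i - x0)) / \<delta>"
    using \<delta>(2) by (rule eventually_mono) (use \<delta>(1) in \<open>simp add: pos_le_divide_eq mult.commute\<close>)
  ultimately have "((\<lambda>i. x i - x0) \<longlongrightarrow> 0) F"
    by (rule Lim_null_comparison[rotated])
  then show ?thesis by (rule LIM_zero_cancel)
qed

lemma has_vector_derivative_iff_quotient:
  "(f has_vector_derivative D) (at x) \<longleftrightarrow> ((\<lambda>y. (f y - f x) /\<^sub>R (y - x)) \<longlongrightarrow> D) (at x)"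
proof -
  have "norm (f y - f x - (y - x) *\<^sub>R D) / norm (y - x) = norm ((f y - f x) /\<^sub>R (y - x) - D)"
    if "y \<noteq> x" for y
  proof -
    have "(f y - f x) /\<^sub>R (y - x) - D = (f y - f x - (y - x) *\<^sub>R D) /\<^sub>R (y - x)"
      using that by (simp add: scaleR_diff_right)
    then show ?thesis by (simp add: divide_inverse mult.commute)
  qed
  then have "((\<lambda>y. norm (f y - f x - (y - x) *\<^sub>R D) / norm (y - x)) \<longlongrightarrow> 0) (at x) \<longleftrightarrow>
      ((\<lambda>y. norm ((f y - f x) /\<^sub>R (y - x) - D)) \<longlongrightarrow> 0) (at x)"
    by (intro filterlim_cong refl) (simp add: eventually_at_filter)
  also have "\<dots> \<longleftrightarrow> ((\<lambda>y. (f y - f x) /\<^sub>R (y - x)) \<longlongrightarrow> D) (at x)"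
    unfolding tendsto_norm_zero_iff by (rule LIM_zero_iff)
  finally show ?thesis
    unfolding has_vector_derivative_def has_derivative_iff_norm
    by (simp add: bounded_linear_scaleR_left)
qed

section \<open>From orthogonal to oblique projections\<close>

lemma orth_proj:
  assumes "csubspace (S :: 'a::fd_complex_hilbert set)"
  shows "orth_proj S u \<in> S" "w \<in> S \<Longrightarrow> cinner w (u - orth_proj S u) = 0"
  using theI'[OF orth_proj_ex1[OF assms, of u]] unfolding orth_proj_apply[OF assms] by auto

lemma orth_proj_eqI:
  assumes "csubspace (S :: 'a::fd_complex_hilbert set)" "v \<in> S" "\<And>w. w \<in> S \<Longrightarrow> cinner w (u - v) = 0"
  shows "orth_proj S u = v"
  unfolding orth_proj_apply[OF assms(1)]
  using orth_proj_ex1[OF assms(1), of u] assms(2,3) by (intro the1_equality conjI) auto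

lemma orth_proj_ident: "csubspace S \<Longrightarrow> u \<in> S \<Longrightarrow> orth_proj S u = u"
  by (rule orth_proj_eqI) auto

lemma clinear_orth_proj:
  assumes "csubspace (S :: 'a::fd_complex_hilbert set)"
  shows "clinear (orth_proj S)"
proof (rule clinearI)
  show "orth_proj S (x + y) = orth_proj S x + orth_proj S y" for x y by (rule blinfun.add_right)
  show "orth_proj S (c *\<^sub>C x) = c *\<^sub>C orth_proj S x" for c x
    using orth_proj(1)[OF assms, of x] orth_proj(2)[OF assms, where u = x] complex_vector.subspace_scale[OF assms]
    by (intro orth_proj_eqI[OF assms])
      (simp_all add: complex_vector.scale_right_diff_distrib[symmetric] cinner_scaleC_right)
qed

text \<open>
  For a plane \<open>L\<close> transversal to \<open>M\<close> this operator is invertible; on \<open>M\<close> it is the orthogonal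
  projection to the complement of \<open>L\<close>, so it determines the \<open>M\<close>-component of \<open>oblique_proj L M u\<close>.
\<close>

definition transversality_op :: "'a::fd_complex_hilbert set \<Rightarrow> 'a set \<Rightarrow> 'a \<Rightarrow>\<^sub>L 'a" where
  "transversality_op L M =
    ((id_blinfun - orth_proj L) o\<^sub>L orth_proj M) + (orth_proj L o\<^sub>L (id_blinfun - orth_proj M))"

lemma transversality_op_apply:
  "transversality_op L M x = (orth_proj M x - orth_proj L (orth_proj M x)) + orth_proj L (x - orth_proj M x)"
  by (simp add: transversality_op_def blinfun.add_left blinfun.diff_left)

lemma transversality_op_M:
  "csubspace M \<Longrightarrow> m \<in> M \<Longrightarrow> transversality_op L M m = m - orth_proj L m"
  by (simp add: transversality_op_apply orth_proj_ident blinfun.zero_right)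

text \<open>The two summands are orthogonal to each other, so both vanish. The first puts the M-part
  of x into L \<inter> M = 0; then the second makes x orthogonal to L as well as to M, hence to
  everything.\<close>

lemma transversality_op_inj:
  assumes T: "transversal L M" and 0: "transversality_op L M x = 0"
  shows "x = 0"
proof -
  note sub = transversalD(3,4)[OF T]
  let ?m = "orth_proj M x"
  let ?a = "?m - orth_proj L ?m" and ?b = "orth_proj L (x - ?m)"
  have b: "?b \<in> L" by (rule orth_proj(1)[OF sub(1)])
  have "cinner ?b ?a = 0" by (rule orth_proj(2)[OF sub(1) b])
  then have "cinner ?b (?a + ?b) = cinner ?b ?b" by (simp only: cinner_add_right add_0)
  moreover have ab: "?a + ?b = 0" using 0 by (simp only: transversality_op_apply)
  ultimately have "cinner ?b ?b = 0" by (simp only: cinner_zero_right)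
  then have "?b = 0" by (simp only: cinner_self_eq_0_iff)
  with ab have "?m = orth_proj L ?m" by simp
  then have "?m \<in> L \<inter> M" using orth_proj(1)[OF sub(1), of ?m] orth_proj(1)[OF sub(2), of x] by simp
  then have m0: "?m = 0" using transversalD(5)[OF T] by simp
  obtain l m where lm: "l \<in> L" "m \<in> M" "x = l + m"
    by (rule Lagrangian_decompose[OF transversalD(1,2,5)[OF T], of x]) blast
  have "cinner m x = 0" using orth_proj(2)[OF sub(2) lm(2), of x] m0 by simp
  moreover have "cinner l x = 0"
    using orth_proj(2)[OF sub(1) lm(1), of x] \<open>?b = 0\<close> m0 by simp
  ultimately have "cinner x x = 0" using cinner_add_left[of l m x] lm(3) by simp
  then show ?thesis by (simp add: cinner_self_eq_0_iff)
qed

lemma transversality_op_surj: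
  assumes T: "transversal L M"
  obtains x where "transversality_op L M x = y"
proof -
  note sub = transversalD(3,4)[OF T]
  note lin = clinear_orth_proj[OF sub(1)] clinear_orth_proj[OF sub(2)]
  have "clinear (transversality_op L M)"
    by (rule clinearI)
      (simp_all add: transversality_op_apply blinfun.add_right clinear_scale[OF lin(1)] clinear_scale[OF lin(2)]
        complex_vector.scale_right_diff_distrib[symmetric] scaleC_add_right[symmetric])
  moreover have "inj (transversality_op L M)"
    using transversality_op_inj[OF T]
    by (intro injI) (metis blinfun.diff_right eq_iff_diff_eq_0)
  ultimately have "surj (transversality_op L M)" by (rule cfd.linear_inj_imp_surj)
  then show ?thesis using that by (metis surjD)
qed

lemma transversality_op_tendsto:
  "((\<lambda>i. orth_proj (Q i)) \<longlongrightarrow> orth_proj L) F \<Longrightarrow>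
    ((\<lambda>i. transversality_op (Q i) M) \<longlongrightarrow> transversality_op L M) F"
  unfolding transversality_op_def by (intro tendsto_intros)

text \<open>The operator kills \<open>Q i\<close> \<inter> M, which the persisting lower bound
  forbids for nonzero vectors.\<close>

lemma eventually_transversal:
  assumes P: "((\<lambda>i. orth_proj (Q i)) \<longlongrightarrow> orth_proj L) F" and T: "transversal L M"
    and Q: "\<forall>\<^sub>F i in F. Lagrangian (Q i)"
  shows "\<forall>\<^sub>F i in F. transversal (Q i) M"
proof -
  obtain \<delta> where \<delta>: "\<delta> > 0" "\<forall>\<^sub>F i in F. \<forall>x. \<delta> * norm x \<le> norm (transversality_op (Q i) M x)"
    by (rule eventually_bounded_below[OF transversality_op_tendsto[OF P, of M] transversality_op_inj[OF T]])
  from \<delta>(2) Q show ?thesis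
  proof eventually_elim
    case (elim i)
    have M: "csubspace M" "Lagrangian M" using transversalD[OF T] by auto
    have Qi: "csubspace (Q i)" using elim by (simp add: Lagrangian_csubspace)
    have "m = 0" if "m \<in> Q i" "m \<in> M" for m
    proof -
      have "transversality_op (Q i) M m = 0"
        using that M Qi by (simp add: transversality_op_M orth_proj_ident)
      then have "\<delta> * norm m \<le> 0" using elim(1) by (metis norm_zero)
      then show ?thesis using \<delta>(1) by (simp add: mult_le_0_iff)
    qed
    then show ?case
      using M Qi elim(2) complex_vector.subspace_0 unfolding transversal_def by blast
  qed
qed

text \<open>The vector m shifts the base point within its class modulo M. Taking m = 0 gives
  continuity; taking u + m to be the projection at \<open>t0\<close> turns the right side into a
  difference of orthogonal projections.\<close>

lemma transversality_op_oblique_proj: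
  assumes T: "transversal L M" and m: "m \<in> M"
  shows "transversality_op L M (oblique_proj L M u - u - m) = orth_proj L (u + m) - (u + m)"
proof -
  note sub = transversalD(3,4)[OF T]
  have "oblique_proj L M u - u - m \<in> M"
    using oblique_proj(2)[OF T] m complex_vector.subspace_diff[OF sub(2)] by blast
  then have "transversality_op L M (oblique_proj L M u - u - m) =
      (oblique_proj L M u - u - m) - orth_proj L (oblique_proj L M u - u - m)"
    by (rule transversality_op_M[OF sub(2)])
  also have "\<dots> = orth_proj L (u + m) - (u + m)"
    using orth_proj_ident[OF sub(1) oblique_proj(1)[OF T, of u]]
    by (simp add: blinfun.diff_right blinfun.add_right)
  finally show ?thesis .
qed

lemma oblique_proj_tendsto:
  assumes P: "((\<lambda>i. orth_proj (Q i)) \<longlongrightarrow> orth_proj L) F" and T: "transversal L M"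
    and Q: "\<forall>\<^sub>F i in F. transversal (Q i) M" and u: "(u \<longlongrightarrow> u0) F"
  shows "((\<lambda>i. oblique_proj (Q i) M (u i)) \<longlongrightarrow> oblique_proj L M u0) F"
proof -
  have 0: "0 \<in> M" using transversalD(4)[OF T] complex_vector.subspace_0 by blast
  have "((\<lambda>i. orth_proj (Q i) (u i) - u i) \<longlongrightarrow> orth_proj L u0 - u0) F"
    by (intro tendsto_intros P u)
  moreover have "\<forall>\<^sub>F i in F. orth_proj (Q i) (u i) - u i =
      transversality_op (Q i) M (oblique_proj (Q i) M (u i) - u i)"
    using Q by eventually_elim (use transversality_op_oblique_proj[OF _ 0] in simp)
  ultimately have "((\<lambda>i. transversality_op (Q i) M (oblique_proj (Q i) M (u i) - u i)) \<longlongrightarrow>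
      orth_proj L u0 - u0) F"
    by (rule Lim_transform_eventually)
  moreover have "transversality_op L M (oblique_proj L M u0 - u0) = orth_proj L u0 - u0"
    using transversality_op_oblique_proj[OF T 0, of u0] by simp
  ultimately have "((\<lambda>i. transversality_op (Q i) M (oblique_proj (Q i) M (u i) - u i)) \<longlongrightarrow>
      transversality_op L M (oblique_proj L M u0 - u0)) F"
    by (simp only:)
  then have "((\<lambda>i. oblique_proj (Q i) M (u i) - u i) \<longlongrightarrow> oblique_proj L M u0 - u0) F"
    by (rule tendsto_of_injective_blinfun[OF transversality_op_tendsto[OF P, of M] transversality_op_inj[OF T], rotated])
  from tendsto_add[OF this u] show ?thesis by simp
qed

text \<open>The operator at t maps the difference quotient of the oblique projection to that of the
  orthogonal projection, applied to the fixed vector \<open>v t0\<close>; the latter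
  converges.\<close>

lemma oblique_proj_has_vector_derivative:
  fixes Q :: "real \<Rightarrow> ('k::fd_complex_hilbert \<times> 'k) set"
  assumes P: "(\<lambda>t. orth_proj (Q t)) differentiable (at t0)" and T: "transversal (Q t0) M"
    and Q: "\<forall>\<^sub>F t in at t0. transversal (Q t) M"
  obtains D where "((\<lambda>t. oblique_proj (Q t) M u) has_vector_derivative D) (at t0)"
proof -
  obtain P' where P': "((\<lambda>t. orth_proj (Q t)) has_vector_derivative P') (at t0)"
    using P vector_derivative_works by blast
  have cont: "((\<lambda>t. orth_proj (Q t)) \<longlongrightarrow> orth_proj (Q t0)) (at t0)"
    using differentiable_imp_continuous_within[OF P] by (simp add: continuous_within)
  define v where "v t = oblique_proj (Q t) M u" for t
  have m: "v t0 - u \<in> M" unfolding v_def by (rule oblique_proj(2)[OF T])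
  \<comment> \<open>The limit of the equation for the difference quotients, solved for the
    derivative.\<close>
  obtain D where D: "transversality_op (Q t0) M D = P' (v t0)"
    using transversality_op_surj[OF T] by metis
  have "((\<lambda>t. (orth_proj (Q t) - orth_proj (Q t0)) /\<^sub>R (t - t0)) \<longlongrightarrow> P') (at t0)"
    using P' by (simp only: has_vector_derivative_iff_quotient)
  then have "((\<lambda>t. ((orth_proj (Q t) - orth_proj (Q t0)) /\<^sub>R (t - t0)) (v t0)) \<longlongrightarrow> P' (v t0)) (at t0)"
    by (intro tendsto_intros)
  moreover have "\<forall>\<^sub>F t in at t0. ((orth_proj (Q t) - orth_proj (Q t0)) /\<^sub>R (t - t0)) (v t0) =
      transversality_op (Q t) M ((v t - v t0) /\<^sub>R (t - t0))"
    using Q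
  proof eventually_elim
    case (elim t)
    have "transversality_op (Q t) M (v t - v t0) = orth_proj (Q t) (v t0) - v t0"
      using transversality_op_oblique_proj[OF elim m, of u] by (simp add: v_def)
    also have "\<dots> = (orth_proj (Q t) - orth_proj (Q t0)) (v t0)"
      using orth_proj_ident[OF transversalD(3)[OF T] oblique_proj(1)[OF T, of u]]
      by (simp add: v_def blinfun.diff_left)
    finally show ?case by (simp add: blinfun.scaleR_left blinfun.scaleR_right)
  qed
  ultimately have "((\<lambda>t. transversality_op (Q t) M ((v t - v t0) /\<^sub>R (t - t0))) \<longlongrightarrow>
      transversality_op (Q t0) M D) (at t0)"
    unfolding D by (rule Lim_transform_eventually)
  then have "((\<lambda>t. (v t - v t0) /\<^sub>R (t - t0)) \<longlongrightarrow> D) (at t0)"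
    by (rule tendsto_of_injective_blinfun[OF transversality_op_tendsto[OF cont, of M] transversality_op_inj[OF T], rotated])
  then have "(v has_vector_derivative D) (at t0)" by (simp only: has_vector_derivative_iff_quotient)
  then show ?thesis using that by (simp add: v_def[abs_def])
qed


section \<open>Monotone paths\<close>

lemma Im_cinner: "Im (cinner x y) = - inner x (\<i> *\<^sub>C y)"
  by (simp add: inner_eq_Re_cinner cinner_scaleC_right)

lemma bounded_bilinear_cinner: "bounded_bilinear cinner"
proof
  fix a a' b b' :: 'a and r :: real
  show "cinner (a + a') b = cinner a b + cinner a' b" by (rule cinner_add_left)
  show "cinner a (b + b') = cinner a b + cinner a b'" by (rule cinner_add_right)
  show "cinner (r *\<^sub>R a) b = r *\<^sub>R cinner a b"
    by (simp add: scaleR_scaleC[of r a] cinner_scaleC_left scaleR_conv_of_real)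
  show "cinner a (r *\<^sub>R b) = r *\<^sub>R cinner a b"
    by (simp add: scaleR_scaleC[of r b] cinner_scaleC_right scaleR_conv_of_real)
  \<comment> \<open>The factor 2 comes from bounding real and imaginary parts separately.\<close>
  have "norm (cinner x y) \<le> norm x * norm y * 2" for x y :: 'a
  proof -
    have "\<bar>Re (cinner x y)\<bar> \<le> norm x * norm y"
      using Cauchy_Schwarz_ineq2[of x y] by (simp add: inner_eq_Re_cinner)
    moreover have "\<bar>Im (cinner x y)\<bar> \<le> norm x * norm y"
      using Cauchy_Schwarz_ineq2[of x "\<i> *\<^sub>C y"] by (simp add: Im_cinner norm_scaleC)
    ultimately show ?thesis using cmod_le[of "cinner x y"] by linarith
  qed
  then show "\<exists>K. \<forall>a b :: 'a. norm (cinner a b) \<le> norm a * norm b * K" by blast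
qed

lemma bounded_bilinear_omega: "bounded_bilinear omega"
proof -
  \<comment> \<open>omega u v is the inner product of J u and v, with J(a, b) = (-b, a).\<close>
  have "bounded_linear (\<lambda>u :: 'a \<times> 'a. (- snd u, fst u))"
    by (intro bounded_linear_Pair bounded_linear_minus bounded_linear_fst bounded_linear_snd)
  from bounded_bilinear.comp1[OF bounded_bilinear_cinner this]
  have "bounded_bilinear (\<lambda>(u :: 'a \<times> 'a) v. cinner (- snd u, fst u) v)" .
  moreover have "cinner (- snd u, fst u) v = omega u v" for u v :: "'a \<times> 'a"
    using cinner_add_left[of "snd u" "- snd u" "fst v"]
    by (simp add: omega_def cinner_prod_def eq_neg_iff_add_eq_0 add.commute)
  ultimately show ?thesis by simp
qed

lemmas tendsto_omega = bounded_bilinear.tendsto[OF bounded_bilinear_omega]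
lemmas has_vector_derivative_omega =
  bounded_linear.has_vector_derivative[OF bounded_bilinear.bounded_linear_right[OF bounded_bilinear_omega]]

text \<open>Two lifts of v differ by a path w with w t0 = 0. Its quotients w t / (t - t0) stay in
  the isotropic plane \<open>Q t\<close>, as do the projections of u, which tend to u. So the
  derivative of w pairs to 0 with u, and the value is independent of the lift.\<close>

lemma crossing_form_eqI:
  fixes Q :: "real \<Rightarrow> ('k::fd_complex_hilbert \<times> 'k) set"
  assumes cont: "((\<lambda>t. orth_proj (Q t)) \<longlongrightarrow> orth_proj (Q t0)) (at t0)"
    and lagr: "\<forall>\<^sub>F t in nhds t0. Lagrangian (Q t)" and u: "u \<in> Q t0"
    and v0: "v' t0 = v" and v': "\<forall>\<^sub>F t in nhds t0. v' t \<in> Q t \<and> v' differentiable (at t)"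
    and q: "((\<lambda>t. omega u (v' t)) has_vector_derivative q) (at t0)"
  shows "crossing_form Q t0 u v = q"
  unfolding crossing_form_def
proof (rule the_equality)
  show "\<exists>v'. v' t0 = v \<and> (\<forall>\<^sub>F t in nhds t0. v' t \<in> Q t \<and> v' differentiable (at t)) \<and>
     ((\<lambda>t. omega u (v' t)) has_vector_derivative q) (at t0)"
    using v0 v' q by blast
next
  fix q'
  assume "\<exists>v'. v' t0 = v \<and> (\<forall>\<^sub>F t in nhds t0. v' t \<in> Q t \<and> v' differentiable (at t)) \<and>
     ((\<lambda>t. omega u (v' t)) has_vector_derivative q') (at t0)"
  then obtain v2 where v2: "v2 t0 = v" "\<forall>\<^sub>F t in nhds t0. v2 t \<in> Q t \<and> v2 differentiable (at t)"
    "((\<lambda>t. omega u (v2 t)) has_vector_derivative q') (at t0)"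
    by blast
  define w where "w t = v2 t - v' t" for t
  have "v' differentiable (at t0)" "v2 differentiable (at t0)"
    using eventually_nhds_x_imp_x[OF v'] eventually_nhds_x_imp_x[OF v2(2)] by auto
  then have "w differentiable (at t0)"
    unfolding w_def by (rule differentiable_diff[rotated])
  then obtain w' where w': "(w has_vector_derivative w') (at t0)"
    using vector_derivative_works by blast
  have w0: "w t0 = 0" using v0 v2(1) by (simp add: w_def)
  have "((\<lambda>t. w t /\<^sub>R (t - t0)) \<longlongrightarrow> w') (at t0)"
    using w' by (simp add: has_vector_derivative_iff_quotient w0)
  moreover have "((\<lambda>t. orth_proj (Q t) u) \<longlongrightarrow> orth_proj (Q t0) u) (at t0)"
    by (intro tendsto_intros cont)
  moreover have "orth_proj (Q t0) u = u"
    using eventually_nhds_x_imp_x[OF lagr] u by (simp add: orth_proj_ident Lagrangian_csubspace)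
  ultimately have "((\<lambda>t. omega (orth_proj (Q t) u) (w t /\<^sub>R (t - t0))) \<longlongrightarrow> omega u w') (at t0)"
    using tendsto_omega by fastforce
  \<comment> \<open>At t = t0 the quotient is 0 by the convention on division, so the identity holds
    on a full neighbourhood.\<close>
  moreover have "\<forall>\<^sub>F t in nhds t0. omega (orth_proj (Q t) u) (w t /\<^sub>R (t - t0)) = 0"
    using lagr v' v2(2)
  proof eventually_elim
    case (elim t)
    have sub: "csubspace (Q t)" using elim by (simp add: Lagrangian_csubspace)
    have "w t \<in> Q t" using elim complex_vector.subspace_diff[OF sub] by (simp add: w_def)
    then have "w t /\<^sub>R (t - t0) \<in> Q t"
      using complex_vector.subspace_scale[OF sub] by (simp add: scaleR_scaleC)
    then show ?case using elim orth_proj(1)[OF sub] Lagrangian_omega by blast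
  qed
  then have "\<forall>\<^sub>F t in at t0. 0 = omega (orth_proj (Q t) u) (w t /\<^sub>R (t - t0))"
    unfolding eventually_nhds_conv_at by (auto elim: eventually_mono)
  then have "((\<lambda>t. omega (orth_proj (Q t) u) (w t /\<^sub>R (t - t0))) \<longlongrightarrow> 0) (at t0)"
    by (rule Lim_transform_eventually[OF tendsto_const])
  ultimately have "omega u w' = 0" using tendsto_unique trivial_limit_at by blast
  moreover have "((\<lambda>t. omega u (w t)) has_vector_derivative omega u w') (at t0)"
    by (rule has_vector_derivative_omega[OF w'])
  moreover have "((\<lambda>t. omega u (w t)) has_vector_derivative (q' - q)) (at t0)"
    using has_vector_derivative_diff[OF v2(3) q] by (simp add: w_def omega_diff_right)
  ultimately have "q' - q = 0" using vector_derivative_unique_at by metis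
  then show "q' = q" by simp
qed

text \<open>The projections of u form a lift of \<open>v t0\<close>, and the derivative turns out to
  be the crossing form at \<open>v t0\<close>, which is nonzero because u is not in M.\<close>

lemma Qform_derivative_pos:
  fixes L :: "real \<Rightarrow> ('k::fd_complex_hilbert \<times> 'k) set"
  assumes I: "open I" "t0 \<in> I" and T: "\<And>t. t \<in> I \<Longrightarrow> transversal (L t) M"
    and P: "\<And>t. t \<in> I \<Longrightarrow> (\<lambda>t. orth_proj (L t)) differentiable (at t)"
    and pos: "positive_definite_on (L t0) (crossing_form L t0)"
    and u: "u \<notin> M"
  shows "\<exists>y. DERIV (\<lambda>t. Re (omega u (oblique_proj (L t) M u))) t0 :> y \<and> y > 0"
proof -
  define v where "v t = oblique_proj (L t) M u" for t
  have nhds: "\<forall>\<^sub>F t in nhds s. t \<in> I" if "s \<in> I" for s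
    using I(1) that by (simp add: eventually_nhds_in_open)
  have D: "\<exists>D. (v has_vector_derivative D) (at s)" if s: "s \<in> I" for s
  proof -
    have "\<forall>\<^sub>F t in at s. transversal (L t) M"
      using nhds[OF s] T by (auto simp: eventually_at_filter elim: eventually_mono)
    then show ?thesis
      using oblique_proj_has_vector_derivative[OF P[OF s] T[OF s]] unfolding v_def by metis
  qed
  then obtain D where D0: "(v has_vector_derivative D) (at t0)" using I(2) by blast
  have v_in: "v t \<in> L t" "v t - u \<in> M" if "t \<in> I" for t
    unfolding v_def using oblique_proj[OF T[OF that]] by auto
  have "v differentiable (at t)" if "t \<in> I" for t
    using D[OF that] by (auto simp: has_vector_derivative_def differentiable_def)
  then have lift: "\<forall>\<^sub>F t in nhds t0. v t \<in> L t \<and> v differentiable (at t)"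
    using nhds[OF I(2)] v_in by (auto elim: eventually_mono)
  have cont: "((\<lambda>t. orth_proj (L t)) \<longlongrightarrow> orth_proj (L t0)) (at t0)"
    using differentiable_imp_continuous_within[OF P[OF I(2)]] by (simp add: continuous_within)
  have lagr: "\<forall>\<^sub>F t in nhds t0. Lagrangian (L t)"
    using nhds[OF I(2)] by (rule eventually_mono) (use T transversalD(1) in blast)
  have "crossing_form L t0 (v t0) (v t0) = omega (v t0) D"
    by (rule crossing_form_eqI[OF cont lagr v_in(1)[OF I(2)] refl lift has_vector_derivative_omega[OF D0]])
  moreover have "v t0 \<noteq> 0"
  proof
    assume "v t0 = 0"
    then have "- u \<in> M" using v_in(2)[OF I(2)] by simp
    then show False
      using u complex_vector.subspace_neg[OF transversalD(4)[OF T[OF I(2)]], of "- u"] by simp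
  qed
  ultimately have pos': "Re (omega (v t0) D) > 0"
    using pos v_in(1)[OF I(2)] unfolding positive_definite_on_def by metis
  \<comment> \<open>m and \<open>v t - u\<close> both lie in M, so omega m (v t) is constant.
    Replacing \<open>v t0\<close> by u in the first slot therefore leaves the derivative
    unchanged.\<close>
  define m where "m = v t0 - u"
  have m: "m \<in> M" using v_in(2)[OF I(2)] by (simp add: m_def)
  have "omega m (v t) = omega m u" if "t \<in> I" for t
    using Lagrangian_omega[OF transversalD(2)[OF T[OF I(2)]] m v_in(2)[OF that]]
    by (simp add: omega_diff_right)
  then have "((\<lambda>t. omega m (v t)) has_vector_derivative 0) (at t0)"
    using has_vector_derivative_transform_within_open[OF has_vector_derivative_const I, of "omega m u"]
    by simp
  then have "omega m D = 0"
    using has_vector_derivative_omega[OF D0, of m] vector_derivative_unique_at by metis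
  then have "omega (v t0) D = omega u D"
    using omega_add_left[of u m D] by (simp add: m_def)
  moreover have "((\<lambda>t. Re (omega u (v t))) has_vector_derivative Re (omega u D)) (at t0)"
    by (rule bounded_linear.has_vector_derivative[OF bounded_linear_Re has_vector_derivative_omega[OF D0]])
  ultimately show ?thesis
    using pos' unfolding v_def has_real_derivative_iff_has_vector_derivative by metis
qed

text \<open>A negative definite subspace at \<open>t0\<close> stays so nearby, since its unit sphere
  is compact. Continuity is assumed jointly in t and x, because the points of the sphere vary in the
  argument.\<close>

lemma neg_index_lower_semicontinuous:
  fixes f :: "real \<Rightarrow> 'a::fd_complex_hilbert \<Rightarrow> 'a \<Rightarrow> complex"
  assumes V: "csubspace V" and herm: "\<forall>\<^sub>F t in at t0. hermitian_form V (f t)"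
    and cont: "\<And>X x x0. \<lbrakk>filterlim X (at t0) sequentially; \<And>n. x n \<in> V; x \<longlonglongrightarrow> x0; x0 \<in> V\<rbrakk>
      \<Longrightarrow> (\<lambda>n. Re (f (X n) (x n) (x n))) \<longlonglongrightarrow> Re (f t0 x0 x0)"
  shows "\<forall>\<^sub>F t in at t0. neg_index V (f t0) \<le> neg_index V (f t)"
proof -
  obtain S where S: "csubspace S" "S \<subseteq> V" "negative_definite_on S (f t0)" "cdim S = neg_index V (f t0)"
    using neg_index_attained[OF V] by metis
  let ?K = "S \<inter> sphere 0 1"
  have "\<forall>\<^sub>F t in at t0. \<forall>x\<in>?K. Re (f t x x) < 0"
  proof (rule ccontr)
    assume neg: "\<not> ?thesis"
    \<comment> \<open>Bad points at distance below 1/(n + 1) accumulate at a unit vector of S whose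
      value at \<open>t0\<close> would be nonnegative.\<close>
    have "\<exists>t x. t \<noteq> t0 \<and> dist t t0 < inverse (real (Suc n)) \<and> x \<in> ?K \<and> Re (f t x x) \<ge> 0" for n
    proof (rule ccontr)
      assume "\<not> ?thesis"
      then have "\<forall>t. t \<noteq> t0 \<and> dist t t0 < inverse (real (Suc n)) \<longrightarrow> (\<forall>x\<in>?K. Re (f t x x) < 0)"
        by (meson not_less)
      then show False
        using neg unfolding eventually_at by (metis inverse_positive_iff_positive of_nat_0_less_iff zero_less_Suc UNIV_I)
    qed
    then obtain X x where X: "\<And>n. X n \<noteq> t0" "\<And>n. dist (X n) t0 < inverse (real (Suc n))"
      and x: "\<And>n. x n \<in> ?K" "\<And>n. Re (f (X n) (x n) (x n)) \<ge> 0"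
      by metis
    obtain l r where l: "l \<in> ?K" "strict_mono r" "(x \<circ> r) \<longlonglongrightarrow> l"
      using compact_sphere_Int_csubspace[OF S(1), of 1] x(1) unfolding compact_def by metis
    have "(\<lambda>n. dist (X n) t0) \<longlonglongrightarrow> 0"
      by (rule tendsto_sandwich[OF _ _ tendsto_const LIMSEQ_inverse_real_of_nat])
        (use X(2) in \<open>auto intro!: always_eventually less_imp_le\<close>)
    then have "X \<longlonglongrightarrow> t0" by (rule tendsto_dist_iff[THEN iffD2])
    then have "filterlim (X \<circ> r) (at t0) sequentially"
      using X(1) l(2) by (auto simp: filterlim_at o_def intro: LIMSEQ_subseq_LIMSEQ[unfolded o_def])
    then have "(\<lambda>n. Re (f ((X \<circ> r) n) ((x \<circ> r) n) ((x \<circ> r) n))) \<longlonglongrightarrow> Re (f t0 l l)"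
      by (rule cont[of "X \<circ> r" "x \<circ> r" l]) (use x(1) l S(2) in auto)
    then have "0 \<le> Re (f t0 l l)"
      by (rule LIMSEQ_le_const) (use x(2) in auto)
    moreover have "l \<in> S" "l \<noteq> 0" using l(1) by auto
    ultimately show False using S(3) unfolding negative_definite_on_def by force
  qed
  with herm show ?thesis
  proof eventually_elim
    case (elim t)
    interpret hermitian_form V "f t" by (rule elim)
    have "negative_definite_on S (f t)"
      unfolding negative_definite_on_def
    proof (intro ballI impI)
      fix u assume u: "u \<in> S" "u \<noteq> 0"
      define c where "c = complex_of_real (1 / norm u)"
      have "norm (c *\<^sub>C u) = 1" using u by (simp add: c_def norm_scaleC norm_divide)
      then have "c *\<^sub>C u \<in> ?K" using u complex_vector.subspace_scale[OF S(1)] by simp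
      then have "Re (f t (c *\<^sub>C u) (c *\<^sub>C u)) < 0" using elim by blast
      then have "(cmod c)\<^sup>2 * Re (f t u u) < 0" using u S(2) by (simp add: quadratic_scale subset_iff)
      then show "Re (f t u u) < 0" by (simp add: mult_less_0_iff)
    qed
    then show ?case using neg_index_ge[OF V S(1,2)] S(4) by simp
  qed
qed

text \<open>Both slots are treated at once: the second index is that of the negated form on the
  fixed plane \<alpha>, so all comparisons take place on one space.\<close>

lemma neg_index_increasing_path:
  fixes L :: "real \<Rightarrow> ('k::fd_complex_hilbert \<times> 'k) set"
  assumes path: "Lagrangian_path {-1<..<1} L"
    and diff: "differentiable_path ({-1<..<0} \<union> {0<..<1}) L"
    and incr: "increasing_path ({-1<..<0} \<union> {0<..<1}) L"
    and T0: "transversal (L 0) M" and \<alpha>: "transversal \<alpha> M"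
  shows "\<forall>\<^sub>F t in at 0.
    neg_index \<alpha> (Qform \<alpha> M (L t)) =
      neg_index \<alpha> (Qform \<alpha> M (L 0)) + (if t < 0 then cdim (\<alpha> \<inter> L 0) else 0) \<and>
    neg_index (L t) (Qform (L t) M \<alpha>) =
      neg_index (L 0) (Qform (L 0) M \<alpha>) + (if t < 0 then 0 else cdim (\<alpha> \<inter> L 0))"
proof -
  let ?P = "\<lambda>t. orth_proj (L t)"
  have contP: "(?P \<longlongrightarrow> ?P s) (at s)" if "s \<in> {-1<..<1}" for s
    using path that continuous_on_interior[of "{-1<..<1}" ?P s]
    by (auto simp: Lagrangian_path_def continuous_within)
  have lagr: "\<forall>\<^sub>F t in at 0. Lagrangian (L t)"
    using path eventually_at_in_open'[of "{-1<..<1}" "0::real"]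
    by (auto simp: Lagrangian_path_def elim: eventually_mono)
  have ev_T: "\<forall>\<^sub>F t in at 0. transversal (L t) M"
    by (rule eventually_transversal[OF contP T0 lagr]) auto
  then obtain e where e: "e > 0" "\<And>t. t \<noteq> 0 \<Longrightarrow> dist t 0 < e \<Longrightarrow> transversal (L t) M"
    unfolding eventually_at by auto
  \<comment> \<open>The bound 1 keeps the interval inside the domain of the path.\<close>
  define \<epsilon> where "\<epsilon> = min e 1"
  have \<epsilon>: "\<epsilon> > 0" "\<epsilon> \<le> 1" using e by (auto simp: \<epsilon>_def)
  have T: "transversal (L t) M" if "-\<epsilon> < t" "t < \<epsilon>" for t
    using that e(2)[of t] T0 by (cases "t = 0") (auto simp: \<epsilon>_def)
  define q where "q t u = Re (omega u (oblique_proj (L t) M u))" for t u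
  have q: "Re (Qform \<alpha> M (L t) u u) = q t u" if "-\<epsilon> < t" "t < \<epsilon>" "u \<in> \<alpha>" for t u
    using Qform_eq_omega[OF transversalD(1)[OF \<alpha>] T] that by (simp add: q_def)
  have tendsto: "((\<lambda>i. q (X i) (x i)) \<longlongrightarrow> q s x0) F"
    if "filterlim X (at s) F" "(x \<longlongrightarrow> x0) F" "-\<epsilon> < s" "s < \<epsilon>" for X x x0 s and F :: "'i filter"
  proof -
    have s: "s \<in> {-1<..<1}" using that \<epsilon> by auto
    have "((\<lambda>i. ?P (X i)) \<longlongrightarrow> ?P s) F" using filterlim_compose[OF contP[OF s] that(1)] .
    moreover have "\<forall>\<^sub>F t in at s. t \<in> {-\<epsilon><..<\<epsilon>}"
      using that by (intro eventually_at_in_open') auto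
    then have "\<forall>\<^sub>F i in F. X i \<in> {-\<epsilon><..<\<epsilon>}"
      using that(1) unfolding filterlim_iff by blast
    then have "\<forall>\<^sub>F i in F. transversal (L (X i)) M"
      by (rule eventually_mono) (auto intro: T)
    ultimately show ?thesis
      unfolding q_def using that
      by (intro tendsto_Re tendsto_omega oblique_proj_tendsto T) auto
  qed
  \<comment> \<open>The condition on s and t keeps 0 out of the open interval between them; 0 may be
    an endpoint, where continuity is enough.\<close>
  have mono: "q s u < q t u"
    if st: "s < t" "-\<epsilon> < s" "t < \<epsilon>" "0 \<le> s \<or> t \<le> 0" and u: "u \<in> \<alpha>" "u \<noteq> 0" for s t u
  proof (rule DERIV_pos_imp_increasing_open[OF st(1)])
    have uM: "u \<notin> M" using u transversalD(5)[OF \<alpha>] by blast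
    fix r assume r: "s < r" "r < t"
    define I where "I = {-\<epsilon><..<\<epsilon>} - {0}"
    have I: "open I" "r \<in> I" "I \<subseteq> {-1<..<0} \<union> {0<..<1}" using r st \<epsilon> by (auto simp: I_def)
    have op: "open ({-1<..<0} \<union> {0<..<1::real})" by auto
    have "?P differentiable (at x)" if "x \<in> I" for x
      using diff that I(3) at_within_open[OF _ op, of x]
      unfolding differentiable_path_def differentiable_on_def by (metis subsetD)
    moreover have "positive_definite_on (L r) (crossing_form L r)"
      using incr I unfolding increasing_path_def by blast
    ultimately show "\<exists>y. DERIV (\<lambda>t. q t u) r :> y \<and> y > 0"
      unfolding q_def using uM
      by (intro Qform_derivative_pos[OF I(1,2)]) (auto simp: I_def intro: T)
  next
    have "isCont (\<lambda>t. q t u) r" if "r \<in> {s..t}" for r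
      unfolding isCont_def using that st by (intro tendsto filterlim_ident tendsto_const) auto
    then show "continuous_on {s..t} (\<lambda>t. q t u)"
      by (intro continuous_at_imp_continuous_on) auto
  qed
  let ?f = "\<lambda>t. Qform \<alpha> M (L t)" and ?g = "\<lambda>t u v. - Qform \<alpha> M (L t) u v"
  note sub = transversalD(3)[OF \<alpha>]
  have herm: "hermitian_form \<alpha> (?f t)" "hermitian_form \<alpha> (?g t)" if "-\<epsilon> < t" "t < \<epsilon>" for t
    using hermitian_form_Qform[OF \<alpha> T[OF that]] hermitian_form.hermitian_uminus by auto
  have ev: "\<forall>\<^sub>F t in at 0. -\<epsilon> < t \<and> t < \<epsilon> \<and> t \<noteq> 0"
    using \<epsilon> eventually_at_in_open[of "{-\<epsilon><..<\<epsilon>}" "0::real"] by (auto elim: eventually_mono)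
  have lim: "(\<lambda>n. Re (?f (X n) (x n) (x n))) \<longlonglongrightarrow> Re (?f 0 x0 x0)"
    if X: "filterlim X (at 0) sequentially" and x: "\<And>n. x n \<in> \<alpha>" "x \<longlonglongrightarrow> x0" "x0 \<in> \<alpha>" for X x x0
  proof -
    have "(\<lambda>n. q (X n) (x n)) \<longlonglongrightarrow> q 0 x0" using \<epsilon> by (intro tendsto X x) auto
    moreover have "\<forall>\<^sub>F n in sequentially. -\<epsilon> < X n \<and> X n < \<epsilon> \<and> X n \<noteq> 0"
      using X ev unfolding filterlim_iff by blast
    then have "\<forall>\<^sub>F n in sequentially. q (X n) (x n) = Re (?f (X n) (x n) (x n))"
      by (rule eventually_mono) (use q x in auto)
    ultimately have "(\<lambda>n. Re (?f (X n) (x n) (x n))) \<longlonglongrightarrow> q 0 x0" by (rule Lim_transform_eventually)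
    then show ?thesis using q[of 0 x0] \<epsilon> x by simp
  qed
  have "\<forall>\<^sub>F t in at 0. neg_index \<alpha> (?f 0) \<le> neg_index \<alpha> (?f t)"
    using ev herm by (intro neg_index_lower_semicontinuous sub lim) (auto elim!: eventually_mono)
  moreover have "\<forall>\<^sub>F t in at 0. neg_index \<alpha> (?g 0) \<le> neg_index \<alpha> (?g t)"
  proof (intro neg_index_lower_semicontinuous sub)
    show "\<forall>\<^sub>F t in at 0. hermitian_form \<alpha> (?g t)"
      using ev by (rule eventually_mono) (use herm in auto)
    show "(\<lambda>n. Re (?g (X n) (x n) (x n))) \<longlonglongrightarrow> Re (?g 0 x0 x0)"
      if "filterlim X (at 0) sequentially" "\<And>n. x n \<in> \<alpha>" "x \<longlonglongrightarrow> x0" "x0 \<in> \<alpha>" for X x x0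
      using tendsto_minus[OF lim[OF that]] by simp
  qed
  ultimately show ?thesis using ev
  proof eventually_elim
    case (elim t)
    have t: "-\<epsilon> < t" "t < \<epsilon>" "t \<noteq> 0" using elim by auto
    have z: "-\<epsilon> < (0::real)" "0 < \<epsilon>" using \<epsilon> by auto
    have swap: "neg_index (L s) (Qform (L s) M \<alpha>) = neg_index \<alpha> (?g s)" if "-\<epsilon> < s" "s < \<epsilon>" for s
      by (rule neg_index_Qform_swap[OF \<alpha> T[OF that]])
    have sum: "neg_index \<alpha> (?f s) + neg_index \<alpha> (?g s) + cdim (\<alpha> \<inter> L s) = cdim \<alpha>"
      if "-\<epsilon> < s" "s < \<epsilon>" for s
      using neg_index_Qform_sum[OF \<alpha> T[OF that]] swap[OF that] by simp
    have ker: "cdim (hermitian_form.kernel \<alpha> (?f 0)) = cdim (\<alpha> \<inter> L 0)"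
      "cdim (hermitian_form.kernel \<alpha> (?g 0)) = cdim (\<alpha> \<inter> L 0)"
      using kernel_Qform[OF \<alpha> T0] hermitian_form.kernel_def[OF herm(1)[OF z]]
        hermitian_form.kernel_def[OF herm(2)[OF z]] by auto
    show ?case
    proof (cases "t < 0")
      case True
      obtain P where P: "csubspace P" "P \<subseteq> \<alpha>" "\<forall>x\<in>P. Re (?f 0 x x) \<le> 0"
        "cdim P = neg_index \<alpha> (?f 0) + cdim (\<alpha> \<inter> L 0)"
        using hermitian_form.inertia(2)[OF herm(1)[OF z]] unfolding ker by blast
      have "negative_definite_on P (?f t)"
        unfolding negative_definite_on_def
      proof (intro ballI impI)
        fix x assume x: "x \<in> P" "x \<noteq> 0"
        then have "x \<in> \<alpha>" using P by auto
        then have "Re (?f t x x) < Re (?f 0 x x)"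
          using mono[of t 0 x] x t z True by (simp add: q)
        then show "Re (?f t x x) < 0" using P(3) x by force
      qed
      then have "cdim P \<le> neg_index \<alpha> (?f t)" by (intro neg_index_ge sub P)
      \<comment> \<open>Both indices are now bounded below and the sums at 0 and at t agree, so
        equality holds throughout; in particular \<alpha> \<inter> L t = 0.\<close>
      then show ?thesis
        using elim P(4) sum[OF z] sum[OF t(1,2)] True by (simp add: swap z t)
    next
      case False
      obtain P where P: "csubspace P" "P \<subseteq> \<alpha>" "\<forall>x\<in>P. Re (?g 0 x x) \<le> 0"
        "cdim P = neg_index \<alpha> (?g 0) + cdim (\<alpha> \<inter> L 0)"
        using hermitian_form.inertia(2)[OF herm(2)[OF z]] unfolding ker by blast
      have "negative_definite_on P (?g t)"
        unfolding negative_definite_on_def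
      proof (intro ballI impI)
        fix x assume x: "x \<in> P" "x \<noteq> 0"
        then have "x \<in> \<alpha>" using P by auto
        then have "Re (?f 0 x x) < Re (?f t x x)"
          using mono[of 0 t x] x t z False by (simp add: q)
        then show "Re (?g t x x) < 0" using P(3) x by force
      qed
      then have "cdim P \<le> neg_index \<alpha> (?g t)" by (intro neg_index_ge sub P)
      then show ?thesis
        using elim P(4) sum[OF z] sum[OF t(1,2)] False by (simp add: swap z t)
    qed
  qed
qed

theorem theorem3p2:
  fixes L :: "real \<Rightarrow> ('k :: fd_complex_hilbert \<times> 'k) set"
    and L1 L2 L3 :: "('k \<times> 'k) set"
  assumes "Lagrangian_path {-1<..<1} L"
    and "differentiable_path ({-1<..<0} \<union> {0<..<1}) L"
    and "increasing_path ({-1<..<0} \<union> {0<..<1}) L"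
    and "Lagrangian L1" "Lagrangian L2" "Lagrangian L3"
  shows "\<forall>\<^sub>F t in at 0.
    duistermaat_index (L t) L2 L3 = duistermaat_index (L 0) L2 L3 +
      (if t < 0 then 0 else int (cdim (L2 \<inter> L 0)) - int (cdim (L3 \<inter> L 0))) \<and>
    duistermaat_index (L t) L2 L3 =
      (if t < 0 then duistermaat_index (L 0) L2 L3 else duistermaat_index L2 L3 (L 0)) \<and>
    duistermaat_index L1 (L t) L3 = duistermaat_index L1 (L 0) L3 +
      (if t < 0 then int (cdim (L1 \<inter> L 0)) else int (cdim (L3 \<inter> L 0))) \<and>
    duistermaat_index L1 L2 (L t) = duistermaat_index L1 L2 (L 0) +
      (if t < 0 then int (cdim (L2 \<inter> L 0)) - int (cdim (L1 \<inter> L 0)) else 0) \<and>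
    duistermaat_index L1 L2 (L t) =
      (if t < 0 then duistermaat_index (L 0) L1 L2 else duistermaat_index L1 L2 (L 0))"
proof -
  have L0: "Lagrangian (L 0)" using assms(1) by (simp add: Lagrangian_path_def)
  obtain M where M: "\<And>N. N \<in> {L 0, L1, L2, L3} \<Longrightarrow> transversal N M"
    by (rule common_transversal[of "{L 0, L1, L2, L3}"]) (use assms L0 in auto)
  then have T: "transversal (L 0) M" "transversal L1 M" "transversal L2 M" "transversal L3 M"
    by auto
  have lagr: "\<forall>\<^sub>F t in at 0. Lagrangian (L t)"
    using assms(1) eventually_at_in_open'[of "{-1<..<1}" "0::real"]
    by (auto simp: Lagrangian_path_def elim: eventually_mono)
  have cont: "((\<lambda>t. orth_proj (L t)) \<longlongrightarrow> orth_proj (L 0)) (at 0)"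
    using assms(1) continuous_on_interior[of "{-1<..<1}" "\<lambda>t. orth_proj (L t)" 0]
    by (auto simp: Lagrangian_path_def continuous_within)
  note ix = neg_index_increasing_path[OF assms(1-3) T(1)]
  \<comment> \<open>With \<open>L 0\<close> as first plane every instance has the same right side
    \<open>cdim (L 0)\<close>. It cancels in differences of indices, which turns the dimension
    formulas into the cyclically permuted ones.\<close>
  note sum = neg_index_Qform_sum[OF T(1)]
  from eventually_transversal[OF cont T(1) lagr] ix[OF T(2)] ix[OF T(3)] ix[OF T(4)]
  show ?thesis
  proof eventually_elim
    case (elim t)
    note eq = duistermaat_index_eq
    show ?case
      unfolding eq[OF elim(1) T(3,4)] eq[OF T(1,3,4)] eq[OF T(3,4,1)] eq[OF T(2) elim(1) T(4)]
        eq[OF T(2,1,4)] eq[OF T(2,3) elim(1)] eq[OF T(2,3,1)] eq[OF T(1,2,3)]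
      using elim sum[OF T(2)] sum[OF T(3)] sum[OF T(4)] by (auto simp: Int_commute)
  qed
qed

end
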